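(* For every complex $m\times n$ matrix $A$ we have $$\sigma_2(A)\le 4\sqrt{\left\|A-\rho(A)J_{m,n}\right\|_\square\, mn}\qquad(1)$$ and $$\sigma_2(A)< C\left\|A-\rho(A)J_{m,n}\right\|_{\boxdot}\sqrt{\log m\,\log n}\qquad(2)$$ for some positive constant $C<10^5$. Inequalities (1) and (2) are tight up to constant factors.
   Context: For a complex $m\times n$ matrix $A=[a_{ij}]$: $\sigma_1(A)\ge\sigma_2(A)\ge\cdots$ are the singular values of $A$ (with $\sigma_i(A)=0$ for $i>\min(m,n)$); for $X\subset[m]=\{1,\dots,m\}$ and $Y\subset[n]=\{1,\dots,n\}$, $A[X,Y]$ is the submatrix of all $a_{ij}$ with $i\in X$, $j\in Y$; $\Sigma(M)$ is the sum of the entries of a matrix $M$ (zero if the matrix is empty); $\rho(A)=\Sigma(A)/(mn)$; $J_{m,n}$ is the $m\times n$ all-ones matrix. The cut-norm is $$\|A\|_\square=\max_{X\subset[m],\,Y\subset[n]}\frac1{mn}\left|\Sigma(A[X,Y])\right|,$$ and the norm $\|A\|_{\boxdot}$ is $$\|A\|_{\boxdot}=\max_{X\subset[m],\ Y\subset[n],\ X,Y\neq\varnothing}\frac{1}{\sqrt{|X||Y|}}\left|\Sigma(A[X,Y])\right|.$$ $\log$ denotes the natural logarithm.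
   Formalization: (1) and its tightness are stated for matrices with all |a_ij| ≤ 1, since (1) fails for A = 100 I_2; in (2) the inequality is ≤ for every A and strict when m, n ≥ 2 and A ≠ ρ(A)J, since otherwise both sides are 0. *)

theory Defs
  imports
    Complex_Main
    "HOL-Library.Multiset"
    "HOL-Computational_Algebra.Fundamental_Theorem_Algebra"
    "Jordan_Normal_Form.Char_Poly"
    "Jordan_Normal_Form.Schur_Decomposition"
    "Jordan_Normal_Form.DL_Submatrix"
begin

text \<open>Rows and columns are indexed by \<open>{..<m}\<close> and \<open>{..<n}\<close>, following
  \<open>Jordan_Normal_Form.Matrix\<close>.\<close>

definition entry_sum :: "complex mat \<Rightarrow> complex" where
  "entry_sum M = (\<Sum>i<dim_row M. \<Sum>j<dim_col M. M $$ (i, j))"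

definition density :: "complex mat \<Rightarrow> complex" where
  "density A = entry_sum A / (of_nat (dim_row A) * of_nat (dim_col A))"

definition ones_mat :: "nat \<Rightarrow> nat \<Rightarrow> complex mat" where
  "ones_mat m n = mat m n (\<lambda>_. 1)"

definition cut_norm :: "complex mat \<Rightarrow> real" where
  "cut_norm A =
     Max ((\<lambda>(X, Y). 1 / (real (dim_row A) * real (dim_col A))
                      * cmod (entry_sum (submatrix A X Y)))
          ` (Pow {..<dim_row A} \<times> Pow {..<dim_col A}))"

definition boxdot_norm :: "complex mat \<Rightarrow> real" where
  "boxdot_norm A =
     Max ((\<lambda>(X, Y). 1 / sqrt (real (card X) * real (card Y))
                      * cmod (entry_sum (submatrix A X Y)))
          ` ((Pow {..<dim_row A} - {{}}) \<times> (Pow {..<dim_col A} - {{}})))"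

text \<open>The eigenvalues of \<open>A\<^sup>* A\<close>, repeated according to their algebraic multiplicity, are real
  and nonnegative, so that \<open>Re\<close> loses nothing. The list has length \<open>dim_col A\<close>.\<close>

definition gram_eigenvalues :: "complex mat \<Rightarrow> real list" where
  "gram_eigenvalues A =
     rev (sorted_list_of_multiset (image_mset Re (proots (char_poly (mat_adjoint A * A)))))"

text \<open>Singular values are numbered from 1; index 0 is a dummy.\<close>

definition singular_value :: "complex mat \<Rightarrow> nat \<Rightarrow> real" where
  "singular_value A i =
     (if 1 \<le> i \<and> i \<le> min (dim_row A) (dim_col A) then sqrt (gram_eigenvalues A ! (i - 1)) else 0)"

end

theory Submission
  imports Defs "HOL-Analysis.L2_Norm"
begin

text \<open>Write \<open>J\<close> for the all-ones matrix, \<open>\<rho>\<close> for the density of \<open>A\<close> and \<open>B = A - \<rho> J\<close>.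

\<^bold>\<open>Upper bounds.\<close> The span of two orthogonal eigenvectors of \<open>A\<^sup>* A\<close> for its two largest
eigenvalues has dimension two, so it meets every hyperplane: there is \<open>x \<noteq> 0\<close> in the hyperplane with
\<open>\<sigma>\<^sub>2 \<parallel>x\<parallel> \<le> \<parallel>A x\<parallel>\<close> (\<open>singular_value_2_le_on_hyperplane\<close>). The choice of the hyperplane removes the
rank-one part of \<open>A\<close>, and \<open>\<parallel>A x\<parallel>\<close> is then bounded by a bilinear form in \<open>B\<close>. Both norms
bound the sums of \<open>B\<close> over all rectangles; the passage from indicator vectors to arbitrary vectors
writes a nonnegative vector as a combination of the indicators of its superlevel sets
(\<open>layer_cake_bound\<close>).

For the cut-norm, take the hyperplane of all \<open>x\<close> with entry sum of \<open>A x\<close> equal to \<open>0\<close>. There \<open>A x = D x\<close>,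
where \<open>D\<close> is \<open>A\<close> with the mean of each column subtracted. By the Schur test, \<open>\<parallel>D x\<parallel>\<^sup>2 \<le> K \<parallel>x\<parallel>\<^sup>2\<close> if the rows
of \<open>D\<^sup>* D\<close> have absolute sum at most \<open>K\<close>. The columns of \<open>D\<close> sum to \<open>0\<close>, so \<open>D\<^sup>* D = D\<^sup>* B\<close>, and such a
row sum is the bilinear form of \<open>B\<close> in a conjugated column of \<open>D\<close> and a vector of unimodular numbers
or zeros. A column of \<open>D\<close> may have entries of modulus close to \<open>2\<close>, but, as \<open>A\<close> has its
entries in the unit disc, it is a vector with entries in the disc translated by a point of the disc, so its real and imaginary parts range over intervals of
length \<open>2\<close> that contain \<open>0\<close>: each side of the form costs a factor \<open>4\<close>, whence \<open>K = 16 m n \<parallel>B\<parallel>\<close> in the cut-norm,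
and \<open>\<sigma>\<^sub>2 \<le> \<surd>K\<close>.

For the boxdot norm, take the hyperplane of all \<open>x\<close> with entry sum \<open>0\<close>, where \<open>A x = B x\<close>. The indicator of a
\<open>k\<close>-set now costs \<open>\<surd>k\<close>; with \<open>\<surd>k - \<surd>(k - 1) \<le> 1 / \<surd>k\<close> and the Cauchy-Schwarz inequality,
a nonnegative vector \<open>x\<close> costs at most \<open>\<parallel>x\<parallel>\<close> times the square root of a harmonic number. This gives the
logarithms, with constant \<open>12\<close>. Any larger constant makes the inequality strict when \<open>m, n \<ge> 2\<close> and \<open>B \<noteq> 0\<close>.

\<^bold>\<open>Tightness.\<close> Both examples are block matrices with two nonzero blocks, \<open>w z\<^sup>T\<close> and \<open>- w z\<^sup>T\<close>, on the
diagonal (\<open>two_block_mat\<close>). Opposite signs give density \<open>0\<close>, two disjoint copies give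
\<open>\<sigma>\<^sub>1 = \<sigma>\<^sub>2 = \<parallel>w\<parallel> \<parallel>z\<parallel>\<close>. For the cut-norm, \<open>w\<close> and \<open>z\<close> are all-ones vectors whose dimensions
have a product of order \<open>\<epsilon> m n\<close>. For the boxdot norm, their entries are \<open>1 / \<surd>i\<close>: every
\<open>k\<close> of their entries sum to at most \<open>2 \<surd>k\<close>, whereas their squared norm is harmonic.\<close>

section \<open>From subset sums to weighted sums\<close>

text \<open>Abel summation without sorting: \<open>g\<close> ranks the indices by decreasing \<open>x\<close>, and the superlevel sets of
\<open>x\<close> are the sets of the first \<open>k\<close> indices. Rather than fixing an order first, the induction subtracts
the minimum of \<open>x\<close> from all entries, which uses the bound for the whole set once, and removes an
index where the minimum is attained; this index is ranked last.\<close>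
lemma layer_cake_bound:
  fixes f :: "'a \<Rightarrow> complex" and x :: "'a \<Rightarrow> real" and h :: "nat \<Rightarrow> real"
  assumes "finite S" and "\<And>i. i \<in> S \<Longrightarrow> 0 \<le> x i"
    and "\<And>X. X \<subseteq> S \<Longrightarrow> cmod (sum f X) \<le> h (card X)" and h0: "h 0 = 0"
  shows "\<exists>g. bij_betw g S {..<card S} \<and>
    cmod (\<Sum>i\<in>S. of_real (x i) * f i) \<le> (\<Sum>i\<in>S. x i * (h (Suc (g i)) - h (g i)))"
  using assms(1-3)
proof (induction "card S" arbitrary: S x)
  case 0
  then show ?case by (auto simp: bij_betw_def)
next
  case (Suc k)
  then have "S \<noteq> {}" by auto
  define t where "t = Min (x ` S)"
  obtain a where a: "a \<in> S" "x a = t"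
    using Min_in[of "x ` S"] Suc.prems(1) \<open>S \<noteq> {}\<close> unfolding t_def by fastforce
  have t: "t \<le> x i" if "i \<in> S" for i
    unfolding t_def using Suc.prems(1) that by auto
  define S' where "S' = S - {a}"
  have S: "S = insert a S'" "a \<notin> S'" "finite S'" and k: "card S' = k"
    using Suc.hyps(2) Suc.prems(1) a by (auto simp: S'_def)
  obtain g where g: "bij_betw g S' {..<k}"
    and le: "cmod (\<Sum>i\<in>S'. of_real (x i - t) * f i) \<le> (\<Sum>i\<in>S'. (x i - t) * (h (Suc (g i)) - h (g i)))"
  proof -
    have "0 \<le> x i - t" if "i \<in> S'" for i using t[of i] S that by simp
    moreover have "cmod (sum f X) \<le> h (card X)" if "X \<subseteq> S'" for X
      using Suc.prems(3)[of X] S that by auto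
    ultimately show ?thesis
      using that Suc.hyps(1)[of S' "\<lambda>i. x i - t"] k S(3) by auto
  qed
  define g' where "g' = g(a := k)"
  have g': "g' a = k" "\<And>i. i \<in> S' \<Longrightarrow> g' i = g i"
    using S by (auto simp: g'_def)
  have "bij_betw g' S' {..<k}"
    using g bij_betw_cong[of S' g g'] g'(2) by auto
  then have bij: "bij_betw g' S {..<card S}"
    using notIn_Un_bij_betw[of a S' g' "{..<k}"] S k g' by (simp add: lessThan_Suc)
  have tele: "(\<Sum>i\<in>S'. h (Suc (g i)) - h (g i)) = h k"
    using sum.reindex_bij_betw[OF g, of "\<lambda>j. h (Suc j) - h j"] sum_lessThan_telescope[of h k] h0 by simp
  have "(\<Sum>i\<in>S. of_real (x i) * f i) = of_real t * sum f S + (\<Sum>i\<in>S'. of_real (x i - t) * f i)"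
    using S a by (simp add: algebra_simps sum_subtractf sum_distrib_left)
  then have "cmod (\<Sum>i\<in>S. of_real (x i) * f i) \<le> t * h (Suc k) + (\<Sum>i\<in>S'. (x i - t) * (h (Suc (g i)) - h (g i)))"
  proof -
    have "0 \<le> t" using a Suc.prems(2) by auto
    moreover have "cmod (sum f S) \<le> h (Suc k)"
      using Suc.prems(3)[of S] Suc.hyps(2) by simp
    ultimately have "cmod (of_real t * sum f S) \<le> t * h (Suc k)"
      by (simp add: norm_mult mult_left_mono)
    then show ?thesis
      using le norm_triangle_ineq[of "of_real t * sum f S" "\<Sum>i\<in>S'. of_real (x i - t) * f i"]
        \<open>(\<Sum>i\<in>S. of_real (x i) * f i) = _\<close> by simp
  qed
  also have "\<dots> = t * (h (Suc k) - h k) + (\<Sum>i\<in>S'. x i * (h (Suc (g i)) - h (g i)))"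
  proof -
    have "(\<Sum>i\<in>S'. (x i - t) * (h (Suc (g i)) - h (g i))) =
        (\<Sum>i\<in>S'. x i * (h (Suc (g i)) - h (g i))) - t * (\<Sum>i\<in>S'. h (Suc (g i)) - h (g i))"
      unfolding sum_distrib_left sum_subtractf[symmetric] by (simp only: left_diff_distrib)
    then show ?thesis unfolding tele by (simp only: right_diff_distrib)
  qed
  also have "\<dots> = (\<Sum>i\<in>S. x i * (h (Suc (g' i)) - h (g' i)))"
    using S g' a by simp
  finally show ?case using bij by blast
qed

text \<open>The step function \<open>h\<close> that jumps from \<open>0\<close> to \<open>K\<close> at \<open>1\<close> charges only the largest weight.\<close>
lemma weighted_sum_bound_nonneg:
  fixes f :: "'a \<Rightarrow> complex" and x :: "'a \<Rightarrow> real"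
  assumes "finite S" and "\<And>i. i \<in> S \<Longrightarrow> 0 \<le> x i" "\<And>i. i \<in> S \<Longrightarrow> x i \<le> t" "0 \<le> t"
    and K: "\<And>X. X \<subseteq> S \<Longrightarrow> cmod (sum f X) \<le> K"
  shows "cmod (\<Sum>i\<in>S. of_real (x i) * f i) \<le> t * K"
proof -
  have "0 \<le> K" using K[of "{}"] by simp
  have "cmod (sum f X) \<le> (if card X = 0 then 0 else K)" if "X \<subseteq> S" for X
    using K[OF that] finite_subset[OF that assms(1)] by auto
  then obtain g where g: "bij_betw g S {..<card S}" and
    le: "cmod (\<Sum>i\<in>S. of_real (x i) * f i) \<le>
      (\<Sum>i\<in>S. x i * ((if Suc (g i) = 0 then 0 else K) - (if g i = 0 then 0 else K)))"
    using layer_cake_bound[OF assms(1), where f = f and x = x and h = "\<lambda>k. if k = 0 then 0 else K"] assms(2) by auto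
  have "(\<Sum>i\<in>S. x i * ((if Suc (g i) = 0 then 0 else K) - (if g i = 0 then 0 else K)))
      \<le> (\<Sum>i\<in>S. if g i = 0 then t * K else 0)"
    using assms(3) \<open>0 \<le> K\<close> by (intro sum_mono) (auto intro: mult_right_mono)
  also have "\<dots> = (\<Sum>j<card S. if j = 0 then t * K else 0)"
    by (rule sum.reindex_bij_betw[OF g])
  also have "\<dots> \<le> t * K"
    using \<open>0 \<le> t\<close> \<open>0 \<le> K\<close> by (simp add: sum.delta)
  finally show ?thesis using le by linarith
qed

lemma cmod_sum_pos_neg_le:
  "cmod (\<Sum>i\<in>S. of_real (x i) * f i) \<le>
    cmod (\<Sum>i\<in>S. of_real (max (x i) 0) * f i) + cmod (\<Sum>i\<in>S. of_real (max (- x i) 0) * f i)"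
proof -
  have "(\<Sum>i\<in>S. of_real (x i) * f i) =
      (\<Sum>i\<in>S. of_real (max (x i) 0) * f i) - (\<Sum>i\<in>S. of_real (max (- x i) 0) * f i)"
    unfolding sum_subtractf[symmetric] by (intro sum.cong) (auto simp: max_def)
  then show ?thesis by (simp add: norm_triangle_ineq4)
qed

lemma weighted_sum_bound_real:
  fixes f :: "'a \<Rightarrow> complex" and x :: "'a \<Rightarrow> real"
  assumes "finite S" and x: "\<And>i. i \<in> S \<Longrightarrow> - q \<le> x i" "\<And>i. i \<in> S \<Longrightarrow> x i \<le> p"
    and pq: "0 \<le> p" "0 \<le> q"
    and K: "\<And>X. X \<subseteq> S \<Longrightarrow> cmod (sum f X) \<le> K"
  shows "cmod (\<Sum>i\<in>S. of_real (x i) * f i) \<le> (p + q) * K"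
proof -
  have "cmod (\<Sum>i\<in>S. of_real (x i) * f i) \<le>
      cmod (\<Sum>i\<in>S. of_real (max (x i) 0) * f i) + cmod (\<Sum>i\<in>S. of_real (max (- x i) 0) * f i)"
    by (rule cmod_sum_pos_neg_le)
  also have "\<dots> \<le> p * K + q * K"
    using x pq by (intro add_mono weighted_sum_bound_nonneg assms) force+
  finally show ?thesis by (simp add: algebra_simps)
qed

lemma cmod_sum_Re_Im_le:
  "cmod (\<Sum>i\<in>S. w i * f i) \<le>
    cmod (\<Sum>i\<in>S. of_real (Re (w i)) * f i) + cmod (\<Sum>i\<in>S. of_real (Im (w i)) * f i)"
proof -
  have "(\<Sum>i\<in>S. w i * f i) =
      (\<Sum>i\<in>S. of_real (Re (w i)) * f i) + \<i> * (\<Sum>i\<in>S. of_real (Im (w i)) * f i)"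
    unfolding sum_distrib_left sum.distrib[symmetric]
    by (intro sum.cong refl, subst complex_eq) (simp add: algebra_simps)
  then show ?thesis
    using norm_triangle_ineq[of "\<Sum>i\<in>S. of_real (Re (w i)) * f i" "\<i> * (\<Sum>i\<in>S. of_real (Im (w i)) * f i)"]
    by (simp add: norm_mult)
qed

text \<open>Each coordinate of \<open>w i - c\<close> lies in an interval of length \<open>2\<close> that contains \<open>0\<close>, so the
translation by \<open>c\<close> costs nothing although it may double the moduli of the weights.\<close>
lemma weighted_sum_bound_disc:
  fixes f w :: "'a \<Rightarrow> complex"
  assumes "finite S" and w: "\<And>i. i \<in> S \<Longrightarrow> cmod (w i) \<le> 1" and c: "cmod c \<le> 1"
    and K: "\<And>X. X \<subseteq> S \<Longrightarrow> cmod (sum f X) \<le> K"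
  shows "cmod (\<Sum>i\<in>S. (w i - c) * f i) \<le> 4 * K"
proof -
  have c': "\<bar>Re c\<bar> \<le> 1" "\<bar>Im c\<bar> \<le> 1"
    using c abs_Re_le_cmod[of c] abs_Im_le_cmod[of c] by linarith+
  have w': "\<bar>Re (w i)\<bar> \<le> 1" "\<bar>Im (w i)\<bar> \<le> 1" if "i \<in> S" for i
    using w[OF that] abs_Re_le_cmod[of "w i"] abs_Im_le_cmod[of "w i"] by linarith+
  have "cmod (\<Sum>i\<in>S. of_real (Re (w i - c)) * f i) \<le> ((1 - Re c) + (1 + Re c)) * K"
    using c' w'(1) by (intro weighted_sum_bound_real assms) (force simp: abs_le_iff)+
  moreover have "cmod (\<Sum>i\<in>S. of_real (Im (w i - c)) * f i) \<le> ((1 - Im c) + (1 + Im c)) * K"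
    using c' w'(2) by (intro weighted_sum_bound_real assms) (force simp: abs_le_iff)+
  ultimately show ?thesis
    using cmod_sum_Re_Im_le[of "\<lambda>i. w i - c" f S] by simp
qed

text \<open>The weights are introduced one side at a time: the sums over a fixed set \<open>Y\<close> of columns are the
coefficients for the row weights, and the results are the subset sums for the column weights.\<close>
lemma cut_bilinear_bound:
  fixes b :: "'a \<Rightarrow> 'b \<Rightarrow> complex"
  assumes "finite S" "finite T"
    and K: "\<And>X Y. X \<subseteq> S \<Longrightarrow> Y \<subseteq> T \<Longrightarrow> cmod (\<Sum>i\<in>X. \<Sum>j\<in>Y. b i j) \<le> K"
    and w: "\<And>i. i \<in> S \<Longrightarrow> cmod (w i) \<le> 1" "cmod c \<le> 1"
    and v: "\<And>j. j \<in> T \<Longrightarrow> cmod (v j) \<le> 1"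
  shows "cmod (\<Sum>i\<in>S. \<Sum>j\<in>T. (w i - c) * b i j * v j) \<le> 16 * K"
proof -
  have "cmod (\<Sum>j\<in>Y. \<Sum>i\<in>S. (w i - c) * b i j) \<le> 4 * K" if "Y \<subseteq> T" for Y
  proof -
    have "cmod (\<Sum>i\<in>S. (w i - c) * (\<Sum>j\<in>Y. b i j)) \<le> 4 * K"
      using K that w by (intro weighted_sum_bound_disc assms) auto
    moreover have "(\<Sum>j\<in>Y. \<Sum>i\<in>S. (w i - c) * b i j) = (\<Sum>i\<in>S. (w i - c) * (\<Sum>j\<in>Y. b i j))"
      by (subst sum.swap) (simp add: sum_distrib_left)
    ultimately show ?thesis by simp
  qed
  then have "cmod (\<Sum>j\<in>T. (v j - 0) * (\<Sum>i\<in>S. (w i - c) * b i j)) \<le> 4 * (4 * K)"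
    using v assms(2) by (intro weighted_sum_bound_disc) auto
  moreover have "(\<Sum>j\<in>T. (v j - 0) * (\<Sum>i\<in>S. (w i - c) * b i j)) = (\<Sum>i\<in>S. \<Sum>j\<in>T. (w i - c) * b i j * v j)"
    by (subst sum.swap) (simp add: sum_distrib_left mult_ac)
  ultimately show ?thesis by simp
qed

definition harmonic :: "nat \<Rightarrow> real" where
  "harmonic n = (\<Sum>k<n. 1 / real (Suc k))"

lemma harmonic_nonneg: "0 \<le> harmonic n"
  unfolding harmonic_def by (intro sum_nonneg) auto

lemma harmonic_0 [simp]: "harmonic 0 = 0"
  and harmonic_Suc [simp]: "harmonic (Suc n) = harmonic n + 1 / real (Suc n)"
  by (simp_all add: harmonic_def)

lemma harmonic_le_ln:
  assumes "0 < n" shows "harmonic n \<le> 1 + ln (real n)"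
  using assms
proof (induction n rule: nat_induct_non_zero)
  case (Suc n)
  have "ln (real n / real (Suc n)) \<le> real n / real (Suc n) - 1"
    using Suc by (intro ln_le_minus_one) auto
  then have "1 / real (Suc n) \<le> ln (real (Suc n)) - ln (real n)"
    using Suc by (simp add: ln_div field_simps)
  then show ?case using Suc by simp
qed simp

lemma ln_le_harmonic: "ln (real (Suc n)) \<le> harmonic n"
proof (induction n)
  case (Suc n)
  have "ln (real (Suc (Suc n)) / real (Suc n)) \<le> real (Suc (Suc n)) / real (Suc n) - 1"
    by (intro ln_le_minus_one) auto
  then have "ln (real (Suc (Suc n))) - ln (real (Suc n)) \<le> 1 / real (Suc n)"
    by (simp add: ln_div field_simps)
  then show ?case using Suc by simp
qed simp

lemma sqrt_Suc_diff_le: "sqrt (real (Suc k)) - sqrt (real k) \<le> 1 / sqrt (real (Suc k))"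
proof -
  have "(sqrt (real (Suc k)) - sqrt (real k)) * sqrt (real (Suc k)) \<le> real (Suc k) - real k"
    using mult_left_mono[of "sqrt (real k)" "sqrt (real (Suc k))" "sqrt (real k)"]
    by (simp add: algebra_simps)
  then show ?thesis by (simp add: field_simps)
qed

text \<open>In the layer-cake bound with \<open>h k = \<beta> \<surd>k\<close>, the weight of rank \<open>k\<close> is charged at most \<open>\<beta> / \<surd>k\<close>; the
Cauchy-Schwarz inequality turns the squares of these charges into a harmonic number.\<close>
lemma sqrt_weighted_sum_bound_nonneg:
  fixes f :: "'a \<Rightarrow> complex" and x :: "'a \<Rightarrow> real"
  assumes "finite S" and x: "\<And>i. i \<in> S \<Longrightarrow> 0 \<le> x i" and "0 \<le> \<beta>"
    and f: "\<And>X. X \<subseteq> S \<Longrightarrow> cmod (sum f X) \<le> \<beta> * sqrt (card X)"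
  shows "cmod (\<Sum>i\<in>S. of_real (x i) * f i)
    \<le> \<beta> * sqrt (harmonic (card S)) * sqrt (\<Sum>i\<in>S. (x i)\<^sup>2)"
proof -
  obtain g where g: "bij_betw g S {..<card S}" and le: "cmod (\<Sum>i\<in>S. of_real (x i) * f i) \<le>
      (\<Sum>i\<in>S. x i * (\<beta> * sqrt (Suc (g i)) - \<beta> * sqrt (g i)))"
    using layer_cake_bound[OF assms(1), where f = f and x = x and h = "\<lambda>k. \<beta> * sqrt (real k)"] x f by auto
  have "(\<Sum>i\<in>S. x i * (\<beta> * sqrt (Suc (g i)) - \<beta> * sqrt (g i))) \<le>
      \<beta> * (\<Sum>i\<in>S. \<bar>x i\<bar> * \<bar>1 / sqrt (real (Suc (g i)))\<bar>)"
    unfolding sum_distrib_left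
  proof (rule sum_mono)
    fix i assume "i \<in> S"
    then have "(\<beta> * x i) * (sqrt (Suc (g i)) - sqrt (g i)) \<le> (\<beta> * x i) * (1 / sqrt (real (Suc (g i))))"
      using sqrt_Suc_diff_le[of "g i"] x \<open>0 \<le> \<beta>\<close> by (intro mult_left_mono) auto
    then show "x i * (\<beta> * sqrt (Suc (g i)) - \<beta> * sqrt (g i)) \<le> \<beta> * (\<bar>x i\<bar> * \<bar>1 / sqrt (real (Suc (g i)))\<bar>)"
      using x[OF \<open>i \<in> S\<close>] by (simp add: algebra_simps)
  qed
  also have "\<dots> \<le> \<beta> * (L2_set x S * L2_set (\<lambda>i. 1 / sqrt (real (Suc (g i)))) S)"
    using \<open>0 \<le> \<beta>\<close> by (intro mult_left_mono L2_set_mult_ineq)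
  also have "L2_set (\<lambda>i. 1 / sqrt (real (Suc (g i)))) S = sqrt (harmonic (card S))"
    unfolding L2_set_def using sum.reindex_bij_betw[OF g, of "\<lambda>k. 1 / real (Suc k)"]
    by (simp add: power_divide harmonic_def)
  finally show ?thesis using le by (simp add: L2_set_def mult_ac)
qed

lemma add_sqrt_le_sqrt2:
  fixes a b :: real assumes "0 \<le> a" "0 \<le> b"
  shows "sqrt a + sqrt b \<le> sqrt 2 * sqrt (a + b)"
proof -
  have "(sqrt a + sqrt b)\<^sup>2 \<le> 2 * (a + b)"
    using assms sum_squares_bound[of "sqrt a" "sqrt b"] by (simp add: power2_sum)
  then show ?thesis by (simp add: real_le_rsqrt real_sqrt_mult[symmetric])
qed

lemma sqrt_weighted_sum_bound_real:
  fixes f :: "'a \<Rightarrow> complex" and x :: "'a \<Rightarrow> real"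
  assumes "finite S" and "0 \<le> \<beta>"
    and f: "\<And>X. X \<subseteq> S \<Longrightarrow> cmod (sum f X) \<le> \<beta> * sqrt (card X)"
  shows "cmod (\<Sum>i\<in>S. of_real (x i) * f i)
    \<le> \<beta> * sqrt (harmonic (card S)) * (sqrt 2 * sqrt (\<Sum>i\<in>S. (x i)\<^sup>2))"
proof -
  define H where "H = \<beta> * sqrt (harmonic (card S))"
  have "0 \<le> H" unfolding H_def using assms by (simp add: harmonic_nonneg)
  have "cmod (\<Sum>i\<in>S. of_real (x i) * f i) \<le>
      cmod (\<Sum>i\<in>S. of_real (max (x i) 0) * f i) + cmod (\<Sum>i\<in>S. of_real (max (- x i) 0) * f i)"
    by (rule cmod_sum_pos_neg_le)
  also have "\<dots> \<le> H * sqrt (\<Sum>i\<in>S. (max (x i) 0)\<^sup>2) + H * sqrt (\<Sum>i\<in>S. (max (- x i) 0)\<^sup>2)"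
    unfolding H_def by (intro add_mono sqrt_weighted_sum_bound_nonneg assms) auto
  also have "\<dots> \<le> H * (sqrt 2 * sqrt ((\<Sum>i\<in>S. (max (x i) 0)\<^sup>2) + (\<Sum>i\<in>S. (max (- x i) 0)\<^sup>2)))"
    unfolding distrib_left[symmetric] using \<open>0 \<le> H\<close>
    by (intro mult_left_mono add_sqrt_le_sqrt2 sum_nonneg) auto
  also have "(\<Sum>i\<in>S. (max (x i) 0)\<^sup>2) + (\<Sum>i\<in>S. (max (- x i) 0)\<^sup>2) = (\<Sum>i\<in>S. (x i)\<^sup>2)"
    unfolding sum.distrib[symmetric] by (intro sum.cong) (auto simp: max_def)
  finally show ?thesis unfolding H_def .
qed

text \<open>The four nonnegative parts of \<open>w\<close> have squared norms that add up to that of \<open>w\<close>, so their norms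
add up to at most twice the norm of \<open>w\<close>.\<close>
lemma sqrt_weighted_sum_bound:
  fixes f w :: "'a \<Rightarrow> complex"
  assumes "finite S" and "0 \<le> \<beta>"
    and f: "\<And>X. X \<subseteq> S \<Longrightarrow> cmod (sum f X) \<le> \<beta> * sqrt (card X)"
  shows "cmod (\<Sum>i\<in>S. w i * f i)
    \<le> 2 * \<beta> * sqrt (harmonic (card S)) * sqrt (\<Sum>i\<in>S. (cmod (w i))\<^sup>2)"
proof -
  define H where "H = \<beta> * sqrt (harmonic (card S))"
  have "0 \<le> H" unfolding H_def using assms by (simp add: harmonic_nonneg)
  have "cmod (\<Sum>i\<in>S. w i * f i) \<le>
      H * (sqrt 2 * sqrt (\<Sum>i\<in>S. (Re (w i))\<^sup>2)) + H * (sqrt 2 * sqrt (\<Sum>i\<in>S. (Im (w i))\<^sup>2))"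
    unfolding H_def
    by (rule order_trans[OF cmod_sum_Re_Im_le]) (intro add_mono sqrt_weighted_sum_bound_real assms)
  also have "\<dots> \<le> H * (sqrt 2 * (sqrt 2 * sqrt ((\<Sum>i\<in>S. (Re (w i))\<^sup>2) + (\<Sum>i\<in>S. (Im (w i))\<^sup>2))))"
    unfolding distrib_left[symmetric] using \<open>0 \<le> H\<close>
    by (intro mult_left_mono add_sqrt_le_sqrt2 sum_nonneg) auto
  also have "(\<Sum>i\<in>S. (Re (w i))\<^sup>2) + (\<Sum>i\<in>S. (Im (w i))\<^sup>2) = (\<Sum>i\<in>S. (cmod (w i))\<^sup>2)"
    by (simp only: sum.distrib[symmetric] cmod_power2)
  also have "H * (sqrt 2 * (sqrt 2 * sqrt (\<Sum>i\<in>S. (cmod (w i))\<^sup>2))) = 2 * H * sqrt (\<Sum>i\<in>S. (cmod (w i))\<^sup>2)"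
    by (simp add: mult.assoc[symmetric] mult.commute)
  finally show ?thesis unfolding H_def by (simp only: mult.assoc)
qed

lemma boxdot_bilinear_bound:
  fixes b :: "'a \<Rightarrow> 'b \<Rightarrow> complex"
  assumes "finite S" "finite T" "0 \<le> \<beta>"
    and b: "\<And>X Y. X \<subseteq> S \<Longrightarrow> Y \<subseteq> T \<Longrightarrow> cmod (\<Sum>i\<in>X. \<Sum>j\<in>Y. b i j) \<le> \<beta> * sqrt (card X) * sqrt (card Y)"
  shows "cmod (\<Sum>i\<in>S. \<Sum>j\<in>T. w i * b i j * v j) \<le>
    4 * \<beta> * sqrt (harmonic (card S)) * sqrt (harmonic (card T))
      * sqrt (\<Sum>i\<in>S. (cmod (w i))\<^sup>2) * sqrt (\<Sum>j\<in>T. (cmod (v j))\<^sup>2)"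
proof -
  define \<gamma> where "\<gamma> = 2 * \<beta> * sqrt (harmonic (card S)) * sqrt (\<Sum>i\<in>S. (cmod (w i))\<^sup>2)"
  have "0 \<le> \<gamma>" unfolding \<gamma>_def using assms(3) by (simp add: harmonic_nonneg sum_nonneg)
  have "cmod (\<Sum>j\<in>Y. \<Sum>i\<in>S. w i * b i j) \<le> \<gamma> * sqrt (card Y)" if "Y \<subseteq> T" for Y
  proof -
    have "cmod (\<Sum>i\<in>S. w i * (\<Sum>j\<in>Y. b i j)) \<le> 2 * (\<beta> * sqrt (card Y)) *
       sqrt (harmonic (card S)) * sqrt (\<Sum>i\<in>S. (cmod (w i))\<^sup>2)"
      using b[OF _ that] assms(3) by (intro sqrt_weighted_sum_bound assms) (auto simp: mult_ac)
    moreover have "(\<Sum>j\<in>Y. \<Sum>i\<in>S. w i * b i j) = (\<Sum>i\<in>S. w i * (\<Sum>j\<in>Y. b i j))"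
      by (subst sum.swap) (simp add: sum_distrib_left)
    ultimately show ?thesis by (simp add: \<gamma>_def mult_ac)
  qed
  then have "cmod (\<Sum>j\<in>T. v j * (\<Sum>i\<in>S. w i * b i j)) \<le>
      2 * \<gamma> * sqrt (harmonic (card T)) * sqrt (\<Sum>j\<in>T. (cmod (v j))\<^sup>2)"
    by (intro sqrt_weighted_sum_bound assms \<open>0 \<le> \<gamma>\<close>)
  moreover have "(\<Sum>j\<in>T. v j * (\<Sum>i\<in>S. w i * b i j)) = (\<Sum>i\<in>S. \<Sum>j\<in>T. w i * b i j * v j)"
    by (subst sum.swap) (simp add: sum_distrib_left mult_ac)
  ultimately show ?thesis by (simp add: \<gamma>_def mult_ac)
qed

section \<open>Eigenvalues of the Gram matrix\<close>

text \<open>Vectors are functions on the indices, so that sums over index sets apply to them directly.\<close>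
definition inner_prod :: "nat \<Rightarrow> (nat \<Rightarrow> complex) \<Rightarrow> (nat \<Rightarrow> complex) \<Rightarrow> complex" where
  "inner_prod n x y = (\<Sum>j<n. cnj (x j) * y j)"

definition sqnorm :: "nat \<Rightarrow> (nat \<Rightarrow> complex) \<Rightarrow> real" where
  "sqnorm n x = (\<Sum>j<n. (cmod (x j))\<^sup>2)"

definition mat_app :: "complex mat \<Rightarrow> (nat \<Rightarrow> complex) \<Rightarrow> nat \<Rightarrow> complex" where
  "mat_app A x i = (\<Sum>j<dim_col A. A $$ (i, j) * x j)"

text \<open>The vector \<open>A\<^sup>* A x\<close>.\<close>
definition gram_app :: "complex mat \<Rightarrow> (nat \<Rightarrow> complex) \<Rightarrow> nat \<Rightarrow> complex" where
  "gram_app A x j = (\<Sum>i<dim_row A. cnj (A $$ (i, j)) * mat_app A x i)"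

lemma inner_prod_self: "inner_prod n x x = of_real (sqnorm n x)"
  unfolding inner_prod_def sqnorm_def of_real_sum
  by (intro sum.cong refl) (simp only: complex_norm_square mult.commute)

lemma inner_prod_commute: "inner_prod n y x = cnj (inner_prod n x y)"
  unfolding inner_prod_def cnj_sum by (simp add: mult.commute)

lemma sqnorm_nonneg: "0 \<le> sqnorm n x"
  unfolding sqnorm_def by (intro sum_nonneg) simp

lemma sqnorm_pos_iff: "0 < sqnorm n x \<longleftrightarrow> (\<exists>j<n. x j \<noteq> 0)"
proof -
  have "sqnorm n x = 0 \<longleftrightarrow> (\<forall>j<n. x j = 0)"
    unfolding sqnorm_def by (subst sum_nonneg_eq_0_iff) auto
  then show ?thesis using sqnorm_nonneg[of n x] by force
qed

lemma sqnorm_lincomb: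
  assumes "inner_prod n p q = 0"
  shows "sqnorm n (\<lambda>j. a * p j + b * q j) = (cmod a)\<^sup>2 * sqnorm n p + (cmod b)\<^sup>2 * sqnorm n q"
proof -
  have "inner_prod n q p = 0" using assms by (simp add: inner_prod_commute[of n q])
  have "inner_prod n (\<lambda>j. a * p j + b * q j) (\<lambda>j. a * p j + b * q j) =
      (cnj a * a) * inner_prod n p p + (cnj a * b) * inner_prod n p q + (cnj b * a) * inner_prod n q p + (cnj b * b) * inner_prod n q q"
    unfolding inner_prod_def sum_distrib_left sum.distrib[symmetric]
    by (intro sum.cong refl) (simp add: algebra_simps)
  also have "\<dots> = of_real ((cmod a)\<^sup>2 * sqnorm n p + (cmod b)\<^sup>2 * sqnorm n q)"
    unfolding assms \<open>inner_prod n q p = 0\<close> inner_prod_self of_real_add of_real_mult complex_norm_square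
    by (simp add: mult.commute)
  finally show ?thesis unfolding inner_prod_self of_real_eq_iff .
qed

lemma mat_app_lincomb: "mat_app A (\<lambda>j. a * x j + b * y j) i = a * mat_app A x i + b * mat_app A y i"
  unfolding mat_app_def sum_distrib_left sum.distrib[symmetric]
  by (intro sum.cong refl) (simp add: algebra_simps)

lemma gram_app_lincomb: "gram_app A (\<lambda>j. a * x j + b * y j) i = a * gram_app A x i + b * gram_app A y i"
  unfolding gram_app_def mat_app_lincomb sum_distrib_left sum.distrib[symmetric]
  by (intro sum.cong refl) (simp add: algebra_simps)

lemma inner_prod_gram_app: "inner_prod (dim_col A) y (gram_app A x) = inner_prod (dim_row A) (mat_app A y) (mat_app A x)"
proof -
  have "inner_prod (dim_col A) y (gram_app A x) =
      (\<Sum>j<dim_col A. \<Sum>i<dim_row A. cnj (y j) * cnj (A $$ (i, j)) * mat_app A x i)"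
    unfolding inner_prod_def gram_app_def by (simp add: sum_distrib_left mult_ac)
  also have "\<dots> = inner_prod (dim_row A) (mat_app A y) (mat_app A x)"
    unfolding inner_prod_def mat_app_def[of A y] cnj_sum sum_distrib_right
    by (subst sum.swap) (simp add: mult_ac)
  finally show ?thesis .
qed

lemma inner_prod_eigen:
  assumes "\<And>j. j < dim_col A \<Longrightarrow> gram_app A x j = e * x j"
  shows "inner_prod (dim_row A) (mat_app A y) (mat_app A x) = e * inner_prod (dim_col A) y x"
  unfolding inner_prod_gram_app[symmetric] using assms by (simp add: inner_prod_def sum_distrib_left mult_ac)

lemma gram_eigenvalue_real:
  assumes "\<And>j. j < dim_col A \<Longrightarrow> gram_app A x j = e * x j" and "0 < sqnorm (dim_col A) x"
  shows "e = of_real (Re e)" "0 \<le> Re e"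
proof -
  have *: "of_real (sqnorm (dim_row A) (mat_app A x)) = e * of_real (sqnorm (dim_col A) x)"
    using inner_prod_eigen[OF assms(1), of x] by (simp add: inner_prod_self)
  then have "e = of_real (sqnorm (dim_row A) (mat_app A x) / sqnorm (dim_col A) x)"
    using assms(2) by (simp add: field_simps)
  then show "e = of_real (Re e)" "0 \<le> Re e"
    using sqnorm_nonneg by (metis Re_complex_of_real, metis Re_complex_of_real divide_nonneg_nonneg)
qed

lemma mat_mult_index:
  assumes "X \<in> carrier_mat n n" "Y \<in> carrier_mat n n" "i < n" "k < n"
  shows "(X * Y) $$ (i, k) = (\<Sum>l<n. X $$ (i, l) * Y $$ (l, k))"
  using assms by (simp add: scalar_prod_def atLeast0LessThan)

lemma gram_mat_carrier: "mat_adjoint A * A \<in> carrier_mat (dim_col A) (dim_col A)"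
  by (intro carrier_matI) (simp_all add: mat_adjoint_def)

lemma gram_mat_index:
  assumes "j < dim_col A" "l < dim_col A"
  shows "(mat_adjoint A * A) $$ (j, l) = (\<Sum>i<dim_row A. cnj (A $$ (i, j)) * A $$ (i, l))"
  using assms by (simp add: mat_adjoint_def scalar_prod_def mat_of_rows_index atLeast0LessThan)

lemma gram_mat_mult_column:
  assumes "j < dim_col A"
  shows "(\<Sum>l<dim_col A. (mat_adjoint A * A) $$ (j, l) * x l) = gram_app A x j"
proof -
  have "(\<Sum>l<dim_col A. (mat_adjoint A * A) $$ (j, l) * x l) =
      (\<Sum>l<dim_col A. \<Sum>i<dim_row A. cnj (A $$ (i, j)) * (A $$ (i, l) * x l))"
    using assms by (intro sum.cong refl) (simp add: gram_mat_index sum_distrib_left sum_distrib_right mult_ac)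
  also have "\<dots> = gram_app A x j"
    unfolding gram_app_def mat_app_def sum_distrib_left by (rule sum.swap)
  finally show ?thesis .
qed

lemma gram_eigenvector_exists:
  assumes "poly (char_poly (mat_adjoint A * A)) e = 0"
  obtains x where "\<And>j. j < dim_col A \<Longrightarrow> gram_app A x j = e * x j" "0 < sqnorm (dim_col A) x"
proof -
  let ?G = "mat_adjoint A * A" and ?n = "dim_col A"
  have dim: "dim_row ?G = ?n" "dim_col ?G = ?n" using gram_mat_carrier[of A] by auto
  obtain v where v: "v \<in> carrier_vec ?n" "v \<noteq> 0\<^sub>v ?n" "?G *\<^sub>v v = e \<cdot>\<^sub>v v"
    using assms eigenvalue_root_char_poly[OF gram_mat_carrier, of A e]
    unfolding eigenvalue_def eigenvector_def dim by auto
  show thesis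
  proof
    fix j assume j: "j < ?n"
    have "e * v $ j = (?G *\<^sub>v v) $ j" using v j by simp
    also have "\<dots> = (\<Sum>l<?n. ?G $$ (j, l) * v $ l)"
      using v(1) j dim by (simp add: scalar_prod_def atLeast0LessThan)
    finally show "gram_app A (($) v) j = e * v $ j"
      using gram_mat_mult_column[OF j] by simp
  next
    show "0 < sqnorm ?n (($) v)"
      unfolding sqnorm_pos_iff using v(1,2) by (metis carrier_vecD dim_vec eq_vecI index_zero_vec)
  qed
qed

lemma proots_prod_linear: "proots (\<Prod>a\<leftarrow>as. [:- a, 1:]) = mset (as :: complex list)"
proof (induction as)
  case (Cons a as)
  have "(\<Prod>a\<leftarrow>as. [:- a, 1:]) \<noteq> 0" by (auto simp: prod_list_zero_iff)
  then have "proots ([:- a, 1:] * (\<Prod>a\<leftarrow>as. [:- a, 1:])) = proots [:- a, 1:] + mset as"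
    unfolding Cons.IH[symmetric] by (intro proots_mult) simp_all
  then show ?case by (simp only: list.map prod_list.Cons proots_linear_factor) simp
qed simp

text \<open>A Gram matrix has only nonnegative real eigenvalues, so the list obtained from the real
parts of the roots still factorises the characteristic polynomial.\<close>
lemma gram_eigenvalues_spec:
  shows "char_poly (mat_adjoint A * A) = (\<Prod>e\<leftarrow>map complex_of_real (gram_eigenvalues A). [:- e, 1:])"
    and "length (gram_eigenvalues A) = dim_col A"
    and "sorted_wrt (\<ge>) (gram_eigenvalues A)"
    and "\<And>e. e \<in> set (gram_eigenvalues A) \<Longrightarrow>
      poly (char_poly (mat_adjoint A * A)) (of_real e) = 0"
    and "\<And>e. e \<in> set (gram_eigenvalues A) \<Longrightarrow> 0 \<le> e"
proof -
  let ?p = "char_poly (mat_adjoint A * A)"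
  obtain as where as: "?p = (\<Prod>a\<leftarrow>as. [:- a, 1:])" "length as = dim_col A"
    using char_poly_factorized[OF gram_mat_carrier] by blast
  have proots: "proots ?p = mset as" unfolding as by (rule proots_prod_linear)
  have root: "poly ?p a = 0" if "a \<in> set as" for a
    unfolding as using that by (simp add: poly_prod_list prod_list_zero_iff image_image)
  have real: "a = of_real (Re a) \<and> 0 \<le> Re a" if a: "a \<in> set as" for a
  proof -
    obtain x where "\<And>j. j < dim_col A \<Longrightarrow> gram_app A x j = a * x j" "0 < sqnorm (dim_col A) x"
      using gram_eigenvector_exists[OF root[OF a]] by blast
    then show ?thesis using gram_eigenvalue_real by blast
  qed
  have mset: "mset (gram_eigenvalues A) = mset (map Re as)"
    unfolding gram_eigenvalues_def proots by simp
  have "mset (map complex_of_real (gram_eigenvalues A)) = image_mset complex_of_real (mset (gram_eigenvalues A))"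
    by simp
  also have "\<dots> = image_mset (\<lambda>a. of_real (Re a)) (mset as)"
    unfolding mset by (simp add: image_mset.compositionality comp_def)
  also have "\<dots> = mset as"
    using real by (metis (no_types, lifting) image_mset_cong image_mset_id set_mset_mset id_apply)
  finally have es: "mset (map complex_of_real (gram_eigenvalues A)) = mset as" .
  show "?p = (\<Prod>e\<leftarrow>map complex_of_real (gram_eigenvalues A). [:- e, 1:])"
    unfolding as prod_mset_prod_list[symmetric] using es by (metis mset_map)
  show "length (gram_eigenvalues A) = dim_col A"
    using mset as(2) by (metis size_mset length_map)
  show "sorted_wrt (\<ge>) (gram_eigenvalues A)"
    unfolding gram_eigenvalues_def by (simp add: sorted_wrt_rev)
  have "set (gram_eigenvalues A) = Re ` set as"
    using mset by (metis set_map set_mset_mset)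
  then show "poly ?p (of_real e) = 0" "0 \<le> e" if "e \<in> set (gram_eigenvalues A)" for e
    using that real root by force+
qed

text \<open>The list is passed to the Schur decomposition in its own decreasing order, which places the largest
eigenvalues first on the diagonal of \<open>B\<close>.\<close>
lemma gram_schur:
  obtains B P Q where "B \<in> carrier_mat (dim_col A) (dim_col A)" "P \<in> carrier_mat (dim_col A) (dim_col A)"
    "Q \<in> carrier_mat (dim_col A) (dim_col A)" "P * Q = 1\<^sub>m (dim_col A)" "Q * P = 1\<^sub>m (dim_col A)"
    "mat_adjoint A * A = P * B * Q" "upper_triangular B"
    "diag_mat B = map complex_of_real (gram_eigenvalues A)"
proof -
  obtain B P Q where BPQ: "schur_decomposition (mat_adjoint A * A) (map complex_of_real (gram_eigenvalues A)) = (B, P, Q)"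
    by (metis prod_cases3)
  note s = schur_decomposition[OF gram_mat_carrier gram_eigenvalues_spec(1) BPQ]
  have "dim_col A = dim_row (mat_adjoint A * A)" using gram_mat_carrier[of A] by (rule carrier_matD(1)[symmetric])
  with s show thesis using similar_mat_witD[of "dim_col A" "mat_adjoint A * A" B P Q] that by blast
qed

text \<open>The first two columns of the Schur basis \<open>P\<close> span an invariant plane, and the first is an eigenvector. If the second
is made orthogonal to the first, self-adjointness removes the off-diagonal coefficient \<open>d\<close>, so it becomes
an eigenvector too. The argument does not distinguish whether the two eigenvalues coincide.\<close>
lemma gram_orthogonal_eigenvectors:
  assumes n: "2 \<le> dim_col A"
  obtains p q where
    "\<And>j. j < dim_col A \<Longrightarrow> gram_app A p j = of_real (gram_eigenvalues A ! 0) * p j"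
    "\<And>j. j < dim_col A \<Longrightarrow> gram_app A q j = of_real (gram_eigenvalues A ! 1) * q j"
    "0 < sqnorm (dim_col A) p" "0 < sqnorm (dim_col A) q" "inner_prod (dim_col A) p q = 0"
proof -
  let ?n = "dim_col A" and ?G = "mat_adjoint A * A"
  let ?l0 = "complex_of_real (gram_eigenvalues A ! 0)" and ?l1 = "complex_of_real (gram_eigenvalues A ! 1)"
  obtain B P Q where B: "B \<in> carrier_mat ?n ?n" and P: "P \<in> carrier_mat ?n ?n" and Q: "Q \<in> carrier_mat ?n ?n"
    and PQ: "P * Q = 1\<^sub>m ?n" "Q * P = 1\<^sub>m ?n" and G: "?G = P * B * Q" and up: "upper_triangular B"
    and diag: "diag_mat B = map complex_of_real (gram_eigenvalues A)"
    by (rule gram_schur[of A])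
  have diag': "B $$ (k, k) = complex_of_real (gram_eigenvalues A ! k)" if "k < ?n" for k
    using arg_cong[OF diag, of "\<lambda>xs. xs ! k"] B that gram_eigenvalues_spec(2)[of A]
    by (simp add: diag_mat_def)
  have GP: "?G * P = P * B"
  proof -
    have "?G * P = P * B * (Q * P)"
      unfolding G by (rule assoc_mult_mat[OF mult_carrier_mat[OF P B] Q P])
    then show ?thesis using PQ P B by simp
  qed
  define p where "p k i = P $$ (i, k)" for k i
  have gp: "gram_app A (p k) i = (\<Sum>l<?n. p l i * B $$ (l, k))" if "i < ?n" "k < ?n" for i k
  proof -
    have "gram_app A (p k) i = (?G * P) $$ (i, k)"
      unfolding mat_mult_index[OF gram_mat_carrier P that] gram_mat_mult_column[OF that(1), symmetric]
      by (simp only: p_def)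
    also have "\<dots> = (\<Sum>l<?n. p l i * B $$ (l, k))"
      unfolding GP mat_mult_index[OF P B that] p_def ..
    finally show ?thesis .
  qed
  have up': "B $$ (l, k) = 0" if "k < l" "l < ?n" for k l
    using up B that by (auto simp: upper_triangular_def)
  have n01: "0 < ?n" "1 < ?n" using n by auto
  have g0: "gram_app A (p 0) i = ?l0 * p 0 i" if "i < ?n" for i
  proof -
    have "gram_app A (p 0) i = (\<Sum>l\<in>{0}. p l i * B $$ (l, 0))"
      unfolding gp[OF that n01(1)]
      using n up' by (intro sum.mono_neutral_right) auto
    then show ?thesis using diag'[of 0] n by simp
  qed
  have g1: "gram_app A (p 1) i = B $$ (0, 1) * p 0 i + ?l1 * p 1 i" if "i < ?n" for i
  proof -
    have "gram_app A (p 1) i = (\<Sum>l\<in>{0, 1}. p l i * B $$ (l, 1))"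
      unfolding gp[OF that n01(2)]
      using n up' by (intro sum.mono_neutral_right) auto
    then show ?thesis using diag'[of 1] n by simp
  qed
  have QP: "(\<Sum>i<?n. Q $$ (k, i) * p l i) = (if k = l then 1 else 0)" if "k < ?n" "l < ?n" for k l
    using mat_mult_index[OF Q P that] that by (simp add: PQ p_def)
  have nz: "\<exists>j<?n. x j \<noteq> 0" if "(\<Sum>i<?n. Q $$ (k, i) * x i) = 1" for x k
    using that by (metis (no_types, lifting) lessThan_iff mult_zero_right sum.neutral zero_neq_one)
  have p0: "0 < sqnorm ?n (p 0)"
    unfolding sqnorm_pos_iff using nz[of 0 "p 0"] QP[of 0 0] n by simp
  \<comment> \<open>One Gram-Schmidt step.\<close>
  define c where "c = - inner_prod ?n (p 0) (p 1) / inner_prod ?n (p 0) (p 0)"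
  define q where "q = (\<lambda>j. c * p 0 j + 1 * p 1 j)"
  have orth: "inner_prod ?n (p 0) q = 0"
  proof -
    have "inner_prod ?n (p 0) q = c * inner_prod ?n (p 0) (p 0) + inner_prod ?n (p 0) (p 1)"
      unfolding inner_prod_def q_def sum_distrib_left sum.distrib[symmetric]
      by (intro sum.cong refl) (simp add: algebra_simps)
    then show ?thesis using p0 unfolding c_def inner_prod_self by simp
  qed
  have q: "0 < sqnorm ?n q"
  proof -
    have "(\<Sum>i<?n. Q $$ (1, i) * q i) = c * (\<Sum>i<?n. Q $$ (1, i) * p 0 i) + (\<Sum>i<?n. Q $$ (1, i) * p 1 i)"
      unfolding q_def sum_distrib_left sum.distrib[symmetric]
      by (intro sum.cong refl) (simp add: algebra_simps)
    also have "\<dots> = 1" using QP[of 1 0] QP[of 1 1] n by simp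
    finally show ?thesis unfolding sqnorm_pos_iff by (rule nz)
  qed
  define d where "d = c * ?l0 + B $$ (0, 1) - ?l1 * c"
  have gq: "gram_app A q j = d * p 0 j + ?l1 * q j" if "j < ?n" for j
    unfolding q_def gram_app_lincomb g0[OF that] g1[OF that] d_def by (simp add: algebra_simps)
  have "d = 0"
  proof -
    have "inner_prod ?n (p 0) (gram_app A q) = d * inner_prod ?n (p 0) (p 0) + ?l1 * inner_prod ?n (p 0) q"
      unfolding inner_prod_def sum_distrib_left sum.distrib[symmetric]
      by (intro sum.cong refl) (simp add: gq algebra_simps)
    moreover have "inner_prod ?n (p 0) (gram_app A q) = cnj (inner_prod ?n q (gram_app A (p 0)))"
      unfolding inner_prod_gram_app by (rule inner_prod_commute)
    moreover have "inner_prod ?n q (gram_app A (p 0)) = ?l0 * inner_prod ?n q (p 0)"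
      unfolding inner_prod_gram_app by (rule inner_prod_eigen) (rule g0)
    ultimately show "d = 0"
      using orth p0 inner_prod_commute[of ?n q "p 0"] by (simp add: inner_prod_self)
  qed
  then show thesis using that[of "p 0" q] g0 gq p0 q orth by simp
qed

text \<open>The trace is invariant under the similarity with the triangular matrix of the Schur decomposition.\<close>
lemma gram_trace: "(\<Sum>j<dim_col A. \<Sum>i<dim_row A. (cmod (A $$ (i, j)))\<^sup>2) = sum_list (gram_eigenvalues A)"
proof -
  let ?n = "dim_col A" and ?G = "mat_adjoint A * A"
  obtain B P Q where B: "B \<in> carrier_mat ?n ?n" and P: "P \<in> carrier_mat ?n ?n" and Q: "Q \<in> carrier_mat ?n ?n"
    and PQ: "Q * P = 1\<^sub>m ?n" and G: "?G = P * B * Q"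
    and diag: "diag_mat B = map complex_of_real (gram_eigenvalues A)"
    by (rule gram_schur[of A])
  have PB: "P * B \<in> carrier_mat ?n ?n" using P B by simp
  have "Q * (P * B) = B" using assoc_mult_mat[OF Q P B] PQ B by simp
  have "complex_of_real (\<Sum>j<?n. \<Sum>i<dim_row A. (cmod (A $$ (i, j)))\<^sup>2) = (\<Sum>j<?n. ?G $$ (j, j))"
    unfolding of_real_sum by (intro sum.cong refl)
      (simp only: gram_mat_index lessThan_iff complex_norm_square mult.commute cong: sum.cong)
  also have "\<dots> = (\<Sum>j<?n. \<Sum>l<?n. (P * B) $$ (j, l) * Q $$ (l, j))"
    unfolding G by (intro sum.cong refl mat_mult_index[OF PB Q]) auto
  also have "\<dots> = (\<Sum>l<?n. \<Sum>j<?n. Q $$ (l, j) * (P * B) $$ (j, l))"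
    by (subst sum.swap) (simp add: mult.commute)
  also have "\<dots> = (\<Sum>l<?n. (Q * (P * B)) $$ (l, l))"
    by (intro sum.cong refl mat_mult_index[OF Q PB, symmetric]) auto
  also have "\<dots> = sum_list (diag_mat B)"
    unfolding \<open>Q * (P * B) = B\<close> diag_mat_def using B by (simp add: sum_list_sum_nth atLeast0LessThan)
  also have "\<dots> = complex_of_real (sum_list (gram_eigenvalues A))"
    unfolding diag by (induction ("gram_eigenvalues A")) simp_all
  finally show ?thesis unfolding of_real_eq_iff .
qed

lemma singular_value_2:
  assumes "2 \<le> dim_row A" "2 \<le> dim_col A"
  shows "singular_value A 2 = sqrt (gram_eigenvalues A ! 1)" "0 \<le> gram_eigenvalues A ! 1"
  using assms gram_eigenvalues_spec(2)[of A] gram_eigenvalues_spec(5)[of _ A] by (auto simp: singular_value_def)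

lemma singular_value_2_trivial:
  "dim_row A < 2 \<or> dim_col A < 2 \<Longrightarrow> singular_value A 2 = 0"
  by (auto simp: singular_value_def)

lemma mat_app_lincomb_fun: "mat_app A (\<lambda>j. a * p j + b * q j) = (\<lambda>i. a * mat_app A p i + b * mat_app A q i)"
  using mat_app_lincomb by blast

text \<open>The half of the Courant-Fischer principle that bounds \<open>\<sigma>\<^sub>2\<close> from above: the plane of the two leading
eigenvectors meets the hyperplane given by \<open>f\<close>, and \<open>\<parallel>A x\<parallel> \<ge> \<sigma>\<^sub>2 \<parallel>x\<parallel>\<close> on the whole plane.\<close>
lemma singular_value_2_le_on_hyperplane:
  assumes "2 \<le> dim_row A" "2 \<le> dim_col A"
  obtains x where "0 < sqnorm (dim_col A) x" "(\<Sum>j<dim_col A. f j * x j) = 0"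
    "(singular_value A 2)\<^sup>2 * sqnorm (dim_col A) x \<le> sqnorm (dim_row A) (mat_app A x)"
proof -
  let ?m = "dim_row A" and ?n = "dim_col A"
  let ?l0 = "gram_eigenvalues A ! 0" and ?l1 = "gram_eigenvalues A ! 1"
  obtain p q where
    p: "\<And>j. j < ?n \<Longrightarrow> gram_app A p j = of_real ?l0 * p j" and
    q: "\<And>j. j < ?n \<Longrightarrow> gram_app A q j = of_real ?l1 * q j" and
    pos: "0 < sqnorm ?n p" "0 < sqnorm ?n q" and orth: "inner_prod ?n p q = 0"
    using gram_orthogonal_eigenvectors[OF assms(2)] by blast
  have le: "?l1 \<le> ?l0"
    using gram_eigenvalues_spec(2,3)[of A] assms(2) by (auto simp: sorted_wrt_iff_nth_less)
  have orth': "inner_prod ?m (mat_app A p) (mat_app A q) = 0"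
    using inner_prod_eigen[OF q, of p] orth by simp
  have Ap: "sqnorm ?m (mat_app A p) = ?l0 * sqnorm ?n p"
    using inner_prod_eigen[OF p, of p] unfolding inner_prod_self of_real_mult[symmetric] of_real_eq_iff .
  have Aq: "sqnorm ?m (mat_app A q) = ?l1 * sqnorm ?n q"
    using inner_prod_eigen[OF q, of q] unfolding inner_prod_self of_real_mult[symmetric] of_real_eq_iff .
  define s t where "s = (\<Sum>j<?n. f j * p j)" and "t = (\<Sum>j<?n. f j * q j)"
  \<comment> \<open>If \<open>s = 0\<close>, then \<open>p\<close> lies in the hyperplane, and the combination with coefficients \<open>t\<close>
    and \<open>- s\<close> might be zero.\<close>
  define a b where "a = (if s = 0 then 1 else t)" and "b = - s"
  define x where "x = (\<lambda>j. a * p j + b * q j)"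
  have x: "sqnorm ?n x = (cmod a)\<^sup>2 * sqnorm ?n p + (cmod b)\<^sup>2 * sqnorm ?n q"
    unfolding x_def by (rule sqnorm_lincomb[OF orth])
  have "sqnorm ?m (mat_app A x) = (cmod a)\<^sup>2 * (?l0 * sqnorm ?n p) + (cmod b)\<^sup>2 * (?l1 * sqnorm ?n q)"
    unfolding x_def mat_app_lincomb_fun sqnorm_lincomb[OF orth'] Ap Aq ..
  also have "\<dots> \<ge> (cmod a)\<^sup>2 * (?l1 * sqnorm ?n p) + (cmod b)\<^sup>2 * (?l1 * sqnorm ?n q)"
    using le pos by (intro add_mono mult_left_mono mult_right_mono) auto
  finally have "?l1 * sqnorm ?n x \<le> sqnorm ?m (mat_app A x)"
    unfolding x by (simp add: algebra_simps)
  then have A: "(singular_value A 2)\<^sup>2 * sqnorm ?n x \<le> sqnorm ?m (mat_app A x)"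
    using singular_value_2[OF assms] by simp
  have "0 < sqnorm ?n x"
  proof (cases "s = 0")
    case True
    then show ?thesis using pos unfolding x a_def b_def by simp
  next
    case False
    then show ?thesis using pos unfolding x b_def by (simp add: add_nonneg_pos)
  qed
  moreover have "(\<Sum>j<?n. f j * x j) = a * s + b * t"
    unfolding x_def s_def t_def sum_distrib_left sum.distrib[symmetric]
    by (intro sum.cong refl) (simp add: algebra_simps)
  then have "(\<Sum>j<?n. f j * x j) = 0" by (auto simp: a_def b_def)
  ultimately show thesis using that A by blast
qed

lemma gram_app_cong:
  "(\<And>j. j < dim_col A \<Longrightarrow> x j = y j) \<Longrightarrow> gram_app A x i = gram_app A y i"
  unfolding gram_app_def mat_app_def by (auto intro!: sum.cong)

text \<open>If the Gram matrix is \<open>s\<close> times a projection, its eigenvalues are \<open>0\<close> and \<open>s\<close>. The trace \<open>2 s\<close>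
then counts exactly two eigenvalues \<open>s\<close>, which come first in the decreasing list.\<close>
lemma gram_eigenvalue_1_of_projection:
  assumes n: "2 \<le> dim_col A" and s: "0 < s"
    and idem: "\<And>x j. j < dim_col A \<Longrightarrow> gram_app A (gram_app A x) j = of_real s * gram_app A x j"
    and tr: "(\<Sum>j<dim_col A. \<Sum>i<dim_row A. (cmod (A $$ (i, j)))\<^sup>2) = 2 * s"
  shows "gram_eigenvalues A ! 1 = s"
proof -
  let ?es = "gram_eigenvalues A" and ?n = "dim_col A"
  have len: "length ?es = ?n" by (rule gram_eigenvalues_spec(2))
  have dich: "e = 0 \<or> e = s" if e: "e \<in> set ?es" for e
  proof -
    obtain x where x: "\<And>j. j < ?n \<Longrightarrow> gram_app A x j = of_real e * x j" "0 < sqnorm ?n x"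
      using gram_eigenvector_exists[OF gram_eigenvalues_spec(4)[OF e]] by blast
    then obtain j where j: "j < ?n" "x j \<noteq> 0" unfolding sqnorm_pos_iff by blast
    have "gram_app A (gram_app A x) j = gram_app A (\<lambda>j. of_real e * x j + 0 * x j) j"
      using x(1) by (intro gram_app_cong) simp
    then have "of_real s * (of_real e * x j) = of_real e * (of_real e * x j)"
      unfolding gram_app_lincomb using idem[OF j(1), of x] x(1)[OF j(1)] by simp
    then have "complex_of_real (s * e) = of_real (e * e)"
      using j(2) by simp
    then show ?thesis unfolding of_real_eq_iff by auto
  qed
  show ?thesis
  proof (rule ccontr)
    assume "?es ! 1 \<noteq> s"
    then have 1: "?es ! 1 = 0" using dich[of "?es ! 1"] n len by auto
    have "?es ! k = 0" if "1 \<le> k" "k < ?n" for k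
    proof -
      have "?es ! k \<le> ?es ! 1"
        using gram_eigenvalues_spec(3)[of A] that len by (cases "k = 1") (auto simp: sorted_wrt_iff_nth_less)
      moreover have "0 \<le> ?es ! k"
        using gram_eigenvalues_spec(5)[of "?es ! k" A] that len by auto
      ultimately show ?thesis using 1 by simp
    qed
    then have "sum_list ?es = (\<Sum>k\<in>{0}. ?es ! k)"
      unfolding sum_list_sum_nth len using n by (intro sum.mono_neutral_right) auto
    also have "\<dots> \<le> s" using dich[of "?es ! 0"] n len s by auto
    finally show False using tr s unfolding gram_trace by simp
  qed
qed

section \<open>Rectangle sums and the two norms\<close>

definition rect_sum :: "complex mat \<Rightarrow> nat set \<Rightarrow> nat set \<Rightarrow> complex" where
  "rect_sum A X Y = (\<Sum>i\<in>X. \<Sum>j\<in>Y. A $$ (i, j))"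

lemma bij_betw_pick:
  assumes "finite X" shows "bij_betw (pick X) {..<card X} X"
proof -
  have inj: "inj_on (pick X) {..<card X}"
    by (rule inj_onI) (metis card_pick_le lessThan_iff)
  moreover have "pick X ` {..<card X} \<subseteq> X" by (auto intro: pick_in_set_le)
  ultimately have "pick X ` {..<card X} = X"
    using assms by (intro card_subset_eq) (auto simp: card_image)
  then show ?thesis using inj by (simp add: bij_betw_def)
qed

lemma entry_sum_submatrix:
  assumes "X \<subseteq> {..<dim_row A}" "Y \<subseteq> {..<dim_col A}"
  shows "entry_sum (submatrix A X Y) = rect_sum A X Y"
proof -
  have fin: "finite X" "finite Y" using assms finite_subset by blast+
  have card: "card {i. i < dim_row A \<and> i \<in> X} = card X" "card {j. j < dim_col A \<and> j \<in> Y} = card Y"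
    using assms by (auto intro!: arg_cong[of _ _ card])
  have "entry_sum (submatrix A X Y) = (\<Sum>i<card X. \<Sum>j<card Y. A $$ (pick X i, pick Y j))"
    unfolding entry_sum_def dim_submatrix card
    by (intro sum.cong refl) (simp add: submatrix_index card)
  also have "\<dots> = (\<Sum>i<card X. \<Sum>j\<in>Y. A $$ (pick X i, j))"
    by (intro sum.cong refl sum.reindex_bij_betw bij_betw_pick fin)
  also have "\<dots> = (\<Sum>i\<in>X. \<Sum>j\<in>Y. A $$ (i, j))"
    by (rule sum.reindex_bij_betw[OF bij_betw_pick[OF fin(1)], of "\<lambda>i. \<Sum>j\<in>Y. A $$ (i, j)"])
  finally show ?thesis by (simp add: rect_sum_def)
qed

lemma rect_sum_le_cut_norm:
  assumes "X \<subseteq> {..<dim_row A}" "Y \<subseteq> {..<dim_col A}"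
  shows "cmod (rect_sum A X Y) / (real (dim_row A) * real (dim_col A)) \<le> cut_norm A"
  unfolding cut_norm_def
  using assms by (intro Max_ge) (auto simp: entry_sum_submatrix intro!: image_eqI[where x = "(X, Y)"])

lemma cut_norm_le:
  assumes "\<And>X Y. X \<subseteq> {..<dim_row A} \<Longrightarrow> Y \<subseteq> {..<dim_col A} \<Longrightarrow>
    cmod (rect_sum A X Y) / (real (dim_row A) * real (dim_col A)) \<le> c"
  shows "cut_norm A \<le> c"
  unfolding cut_norm_def
  using assms by (subst Max_le_iff) (auto simp: entry_sum_submatrix)

lemma cut_norm_nonneg: "0 \<le> cut_norm A"
  using rect_sum_le_cut_norm[of "{}" A "{}"] by (simp add: rect_sum_def)

lemma rect_sum_le_boxdot_norm:
  assumes "X \<subseteq> {..<dim_row A}" "Y \<subseteq> {..<dim_col A}"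
  shows "cmod (rect_sum A X Y) \<le> boxdot_norm A * sqrt (card X) * sqrt (card Y)"
proof (cases "X = {} \<or> Y = {}")
  case True
  then show ?thesis by (auto simp: rect_sum_def)
next
  case False
  have fin: "finite X" "finite Y" using assms finite_subset by blast+
  have "1 / sqrt (real (card X) * real (card Y)) * cmod (rect_sum A X Y) \<le> boxdot_norm A"
    unfolding boxdot_norm_def
    using assms False by (intro Max_ge) (auto simp: entry_sum_submatrix intro!: image_eqI[where x = "(X, Y)"])
  moreover have "0 < card X" "0 < card Y" using False fin by (auto simp: card_gt_0_iff)
  ultimately show ?thesis by (simp add: real_sqrt_mult field_simps)
qed

lemma boxdot_norm_le:
  assumes "0 < dim_row A" "0 < dim_col A"
    and "\<And>X Y. X \<subseteq> {..<dim_row A} \<Longrightarrow> Y \<subseteq> {..<dim_col A} \<Longrightarrow>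
      cmod (rect_sum A X Y) \<le> c * sqrt (card X) * sqrt (card Y)"
  shows "boxdot_norm A \<le> c"
proof -
  let ?R = "(Pow {..<dim_row A} - {{}}) \<times> (Pow {..<dim_col A} - {{}})"
  have "({..<dim_row A}, {..<dim_col A}) \<in> ?R" using assms by auto
  then have "?R \<noteq> {}" by blast
  moreover have "1 / sqrt (real (card X) * real (card Y)) * cmod (entry_sum (submatrix A X Y)) \<le> c"
    if "(X, Y) \<in> ?R" for X Y
  proof -
    have fin: "finite X" "finite Y" using that finite_subset by auto
    then have "0 < card X" "0 < card Y" using that by (auto simp: card_gt_0_iff)
    then show ?thesis
      using that assms(3)[of X Y] by (auto simp: entry_sum_submatrix real_sqrt_mult field_simps)
  qed
  ultimately show ?thesis
    unfolding boxdot_norm_def by (subst Max_le_iff) auto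
qed

lemma entry_le_boxdot_norm:
  assumes "i < dim_row A" "j < dim_col A"
  shows "cmod (A $$ (i, j)) \<le> boxdot_norm A"
  using rect_sum_le_boxdot_norm[of "{i}" A "{j}"] assms by (simp add: rect_sum_def)

lemma boxdot_norm_nonneg:
  assumes "0 < dim_row A" "0 < dim_col A"
  shows "0 \<le> boxdot_norm A"
  using order_trans[OF norm_ge_zero entry_le_boxdot_norm[OF assms]] .

section \<open>Upper bound by the cut-norm\<close>

lemma nonneg_eq_cmod: "complex_of_real r = z \<Longrightarrow> 0 \<le> r \<Longrightarrow> r = cmod z"
  by auto

text \<open>The inequality \<open>2 \<bar>x\<^sub>j\<bar> \<bar>x\<^sub>l\<bar> \<le> \<bar>x\<^sub>j\<bar>\<^sup>2 + \<bar>x\<^sub>l\<bar>\<^sup>2\<close> bounds the quadratic form of \<open>H = D\<^sup>* D\<close> by row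
and column sums of moduli, which agree because \<open>H\<close> is Hermitian.\<close>
lemma schur_test:
  fixes D :: "nat \<Rightarrow> nat \<Rightarrow> complex"
  assumes K: "\<And>j. j < n \<Longrightarrow> (\<Sum>l<n. cmod (\<Sum>i<m. cnj (D i j) * D i l)) \<le> K"
  shows "sqnorm m (\<lambda>i. \<Sum>j<n. D i j * x j) \<le> K * sqnorm n x"
proof -
  define H where "H j l = (\<Sum>i<m. cnj (D i j) * D i l)" for j l
  have sym: "cmod (H l j) = cmod (H j l)" for j l
  proof -
    have "H l j = cnj (H j l)" unfolding H_def cnj_sum by (simp add: mult.commute)
    then show ?thesis by simp
  qed
  have "complex_of_real (sqnorm m (\<lambda>i. \<Sum>j<n. D i j * x j)) =
      (\<Sum>i<m. \<Sum>j<n. \<Sum>l<n. cnj (x j) * (cnj (D i j) * D i l) * x l)"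
    unfolding inner_prod_self[symmetric] inner_prod_def cnj_sum sum_product
    by (simp add: mult_ac)
  also have "\<dots> = (\<Sum>j<n. \<Sum>i<m. \<Sum>l<n. cnj (x j) * (cnj (D i j) * D i l) * x l)"
    by (rule sum.swap)
  also have "\<dots> = (\<Sum>j<n. \<Sum>l<n. \<Sum>i<m. cnj (x j) * (cnj (D i j) * D i l) * x l)"
    by (rule sum.cong[OF refl sum.swap])
  also have "\<dots> = (\<Sum>j<n. \<Sum>l<n. cnj (x j) * H j l * x l)"
    unfolding H_def sum_distrib_left sum_distrib_right by (rule refl)
  finally have "sqnorm m (\<lambda>i. \<Sum>j<n. D i j * x j) = cmod (\<Sum>j<n. \<Sum>l<n. cnj (x j) * H j l * x l)"
    using sqnorm_nonneg by (rule nonneg_eq_cmod)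
  also have "\<dots> \<le> (\<Sum>j<n. \<Sum>l<n. cmod (cnj (x j) * H j l * x l))"
    by (rule order_trans[OF norm_sum sum_mono[OF norm_sum]])
  also have "\<dots> \<le> (\<Sum>j<n. \<Sum>l<n. cmod (H j l) * (cmod (x j))\<^sup>2 / 2 + cmod (H l j) * (cmod (x l))\<^sup>2 / 2)"
  proof (intro sum_mono)
    fix j l
    have "2 * (cmod (x j) * cmod (x l)) \<le> (cmod (x j))\<^sup>2 + (cmod (x l))\<^sup>2"
      using sum_squares_bound[of "cmod (x j)" "cmod (x l)"] by simp
    from mult_left_mono[OF this norm_ge_zero[of "H j l"]]
    show "cmod (cnj (x j) * H j l * x l) \<le> cmod (H j l) * (cmod (x j))\<^sup>2 / 2 + cmod (H l j) * (cmod (x l))\<^sup>2 / 2"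
      unfolding sym[of l j] by (simp add: norm_mult algebra_simps)
  qed
  also have "\<dots> = (\<Sum>j<n. \<Sum>l<n. cmod (H j l) * (cmod (x j))\<^sup>2 / 2) + (\<Sum>j<n. \<Sum>l<n. cmod (H l j) * (cmod (x l))\<^sup>2 / 2)"
    by (simp only: sum.distrib)
  also have "(\<Sum>j<n. \<Sum>l<n. cmod (H l j) * (cmod (x l))\<^sup>2 / 2) = (\<Sum>j<n. \<Sum>l<n. cmod (H j l) * (cmod (x j))\<^sup>2 / 2)"
    by (rule sum.swap)
  also have "(\<Sum>j<n. \<Sum>l<n. cmod (H j l) * (cmod (x j))\<^sup>2 / 2) + (\<Sum>j<n. \<Sum>l<n. cmod (H j l) * (cmod (x j))\<^sup>2 / 2)
      = (\<Sum>j<n. (\<Sum>l<n. cmod (H j l)) * (cmod (x j))\<^sup>2)"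
    unfolding sum.distrib[symmetric] sum_distrib_right by simp
  also have "\<dots> \<le> (\<Sum>j<n. K * (cmod (x j))\<^sup>2)"
    using K unfolding H_def by (intro sum_mono mult_right_mono) auto
  finally show ?thesis by (simp add: sqnorm_def sum_distrib_left)
qed

lemma centred_index:
  assumes "i < dim_row A" "j < dim_col A"
  shows "(A - c \<cdot>\<^sub>m ones_mat (dim_row A) (dim_col A)) $$ (i, j) = A $$ (i, j) - c"
  using assms by (simp add: ones_mat_def)

lemma centred_dims:
  "dim_row (A - c \<cdot>\<^sub>m ones_mat (dim_row A) (dim_col A)) = dim_row A"
  "dim_col (A - c \<cdot>\<^sub>m ones_mat (dim_row A) (dim_col A)) = dim_col A"
  by (simp_all add: ones_mat_def)

text \<open>The constant \<open>c\<close> is arbitrary: it is removed by the vanishing column sums of \<open>D\<close>.\<close>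
lemma singular_value_2_le_cut_norm:
  assumes "\<And>i j. i < dim_row A \<Longrightarrow> j < dim_col A \<Longrightarrow> cmod (A $$ (i, j)) \<le> 1"
  shows "singular_value A 2 \<le> 4 * sqrt (cut_norm (A - c \<cdot>\<^sub>m ones_mat (dim_row A) (dim_col A))
    * (real (dim_row A) * real (dim_col A)))"
proof (cases "2 \<le> dim_row A \<and> 2 \<le> dim_col A")
  case False
  then show ?thesis
    using singular_value_2_trivial[of A] by (auto simp: cut_norm_nonneg not_le)
next
  case True
  define m n where "m = dim_row A" and "n = dim_col A"
  define B where "B = A - c \<cdot>\<^sub>m ones_mat m n"
  define K where "K = cut_norm B * (real m * real n)"
  have mn: "0 < m" "0 < n" using True by (auto simp: m_def n_def)
  have dim: "dim_row B = m" "dim_col B = n" unfolding B_def m_def n_def by (rule centred_dims)+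
  have B: "A $$ (i, j) = B $$ (i, j) + c" if "i < m" "j < n" for i j
    using centred_index[of i A j c] that unfolding B_def m_def n_def by simp
  have K: "cmod (\<Sum>i\<in>X. \<Sum>j\<in>Y. B $$ (i, j)) \<le> K" if "X \<subseteq> {..<m}" "Y \<subseteq> {..<n}" for X Y
    using rect_sum_le_cut_norm[of X B Y] that dim mn by (simp add: rect_sum_def K_def field_simps)
  define \<mu> where "\<mu> j = (\<Sum>i<m. A $$ (i, j)) / of_nat m" for j
  have \<mu>: "cmod (\<mu> j) \<le> 1" if "j < n" for j
  proof -
    have "cmod (\<Sum>i<m. A $$ (i, j)) \<le> (\<Sum>i<m. 1)"
      using assms that by (intro order_trans[OF norm_sum] sum_mono) (auto simp: m_def n_def)
    then show ?thesis using mn by (simp add: \<mu>_def norm_divide field_simps)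
  qed
  define D where "D i j = A $$ (i, j) - \<mu> j" for i j
  have D0: "(\<Sum>i<m. D i j) = 0" for j
    using mn by (simp add: D_def \<mu>_def sum_subtractf)
  have row: "(\<Sum>l<n. cmod (\<Sum>i<m. cnj (D i j) * D i l)) \<le> 16 * K" if j: "j < n" for j
  proof -
    have col: "(\<Sum>i<m. cnj (D i j) * D i l) = (\<Sum>i<m. cnj (D i j) * B $$ (i, l))" if "l < n" for l
    proof -
      have "(\<Sum>i<m. cnj (D i j) * D i l) = (\<Sum>i<m. cnj (D i j) * B $$ (i, l) + cnj (D i j) * (c - \<mu> l))"
        using that by (intro sum.cong refl) (simp add: D_def[of _ l] B algebra_simps)
      also have "\<dots> = (\<Sum>i<m. cnj (D i j) * B $$ (i, l)) + cnj (\<Sum>i<m. D i j) * (c - \<mu> l)"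
        by (simp only: sum.distrib sum_distrib_right cnj_sum)
      finally show ?thesis using D0 by simp
    qed
    define h where "h l = (\<Sum>i<m. cnj (D i j) * B $$ (i, l))" for l
    \<comment> \<open>The moduli are written with unimodular factors to make the row sum a bilinear form of \<open>B\<close>.\<close>
    have "complex_of_real (\<Sum>l<n. cmod (h l)) = (\<Sum>l<n. h l * cnj (sgn (h l)))"
      unfolding of_real_sum
    proof (intro sum.cong refl)
      fix l show "complex_of_real (cmod (h l)) = h l * cnj (sgn (h l))"
        by (cases "h l = 0") (simp_all add: sgn_div_norm scaleR_conv_of_real complex_norm_square[symmetric] power2_eq_square field_simps)
    qed
    also have "\<dots> = (\<Sum>i<m. \<Sum>l<n. (cnj (A $$ (i, j)) - cnj (\<mu> j)) * B $$ (i, l) * cnj (sgn (h l)))"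
      unfolding h_def[of "_ :: nat"] D_def sum_distrib_right
      by (subst sum.swap) simp
    finally have "(\<Sum>l<n. cmod (h l)) =
        cmod (\<Sum>i<m. \<Sum>l<n. (cnj (A $$ (i, j)) - cnj (\<mu> j)) * B $$ (i, l) * cnj (sgn (h l)))"
      by (rule nonneg_eq_cmod) (simp add: sum_nonneg)
    also have "\<dots> \<le> 16 * K"
      using K assms \<mu> j by (intro cut_bilinear_bound) (auto simp: m_def n_def norm_sgn)
    finally show ?thesis unfolding h_def using col by simp
  qed
  obtain x where x: "0 < sqnorm n x" "(\<Sum>j<n. (\<Sum>i<m. A $$ (i, j)) * x j) = 0"
    and le: "(singular_value A 2)\<^sup>2 * sqnorm n x \<le> sqnorm m (mat_app A x)"
    using singular_value_2_le_on_hyperplane[of A "\<lambda>j. \<Sum>i<m. A $$ (i, j)"] True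
    unfolding m_def n_def by blast
  have "(\<Sum>j<n. \<mu> j * x j) = (\<Sum>j<n. (\<Sum>i<m. A $$ (i, j)) * x j) / of_nat m"
    unfolding \<mu>_def sum_divide_distrib[of _ "{..<n}"] by simp
  then have "mat_app A x = (\<lambda>i. \<Sum>j<n. D i j * x j)"
    using x(2) by (auto simp: mat_app_def D_def n_def left_diff_distrib sum_subtractf)
  then have "(singular_value A 2)\<^sup>2 * sqnorm n x \<le> 16 * K * sqnorm n x"
    using le schur_test[where D = D and K = "16 * K" and x = x and m = m and n = n] row by simp
  then have "(singular_value A 2)\<^sup>2 \<le> 16 * K" using x(1) by simp
  then have "singular_value A 2 \<le> sqrt (16 * K)" by (rule real_le_rsqrt)
  also have "sqrt (16 * K) = 4 * sqrt K" by (simp add: real_sqrt_mult)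
  finally show ?thesis unfolding K_def B_def m_def n_def .
qed

section \<open>Upper bound by the boxdot norm\<close>

lemma harmonic_le_3_ln:
  assumes "2 \<le> n" shows "harmonic n \<le> 3 * ln (real n)"
proof -
  have "1 - 1 / 2 \<le> ln (2 :: real)"
    using ln_le_minus_one[of "1 / 2 :: real"] by (simp add: ln_div)
  also have "\<dots> \<le> ln (real n)" using assms by simp
  finally show ?thesis using harmonic_le_ln[of n] assms by simp
qed

text \<open>The constant \<open>c\<close> is arbitrary: it is removed by the vanishing entry sum of \<open>x\<close>.\<close>
lemma singular_value_2_le_boxdot_norm:
  assumes "2 \<le> dim_row A" "2 \<le> dim_col A"
  shows "singular_value A 2 \<le> 12 * boxdot_norm (A - c \<cdot>\<^sub>m ones_mat (dim_row A) (dim_col A))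
    * sqrt (ln (dim_row A) * ln (dim_col A))"
proof -
  define m n where "m = dim_row A" and "n = dim_col A"
  define B where "B = A - c \<cdot>\<^sub>m ones_mat m n"
  define \<beta> where "\<beta> = boxdot_norm B"
  have mn: "2 \<le> m" "2 \<le> n" using assms by (auto simp: m_def n_def)
  have dim: "dim_row B = m" "dim_col B = n" unfolding B_def m_def n_def by (rule centred_dims)+
  have B: "A $$ (i, j) = B $$ (i, j) + c" if "i < m" "j < n" for i j
    using centred_index[of i A j c] that unfolding B_def m_def n_def by simp
  have "0 \<le> \<beta>" unfolding \<beta>_def using dim mn by (intro boxdot_norm_nonneg) auto
  obtain x where x: "0 < sqnorm n x" "(\<Sum>j<n. 1 * x j) = 0"
    and le: "(singular_value A 2)\<^sup>2 * sqnorm n x \<le> sqnorm m (mat_app A x)"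
    using singular_value_2_le_on_hyperplane[of A "\<lambda>_. 1"] assms unfolding m_def n_def by blast
  define y where "y = mat_app A x"
  have y: "y i = (\<Sum>j<n. B $$ (i, j) * x j)" if "i < m" for i
  proof -
    have "(\<Sum>j<n. B $$ (i, j) * x j) = (\<Sum>j<n. A $$ (i, j) * x j - c * (1 * x j))"
      using that by (intro sum.cong refl) (simp add: B algebra_simps)
    also have "\<dots> = y i - c * (\<Sum>j<n. 1 * x j)"
      by (simp only: sum_subtractf sum_distrib_left[symmetric]) (simp add: y_def mat_app_def n_def)
    finally show ?thesis using x(2) by simp
  qed
  have sq: "sqrt (sqnorm m y) * sqrt (sqnorm m y) = sqnorm m y"
    by (simp add: sqnorm_nonneg)
  define c' where "c' = 4 * \<beta> * sqrt (harmonic m) * sqrt (harmonic n)"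
  have "0 \<le> c'" unfolding c'_def using \<open>0 \<le> \<beta>\<close> by (simp add: harmonic_nonneg)
  have "complex_of_real (sqnorm m y) = (\<Sum>i<m. \<Sum>j<n. cnj (y i) * B $$ (i, j) * x j)"
    unfolding inner_prod_self[symmetric] inner_prod_def using y by (simp add: sum_distrib_left mult.assoc)
  then have "sqnorm m y = cmod (\<Sum>i<m. \<Sum>j<n. cnj (y i) * B $$ (i, j) * x j)"
    using sqnorm_nonneg by (rule nonneg_eq_cmod)
  also have "\<dots> \<le> c' * sqrt (sqnorm m y) * sqrt (sqnorm n x)"
    using boxdot_bilinear_bound[of "{..<m}" "{..<n}" \<beta> "\<lambda>i j. B $$ (i, j)" "\<lambda>i. cnj (y i)" x]
      rect_sum_le_boxdot_norm[of _ B] dim \<open>0 \<le> \<beta>\<close>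
    by (simp add: rect_sum_def \<beta>_def c'_def sqnorm_def)
  finally have *: "sqrt (sqnorm m y) * sqrt (sqnorm m y) \<le> sqrt (sqnorm m y) * (c' * sqrt (sqnorm n x))"
    unfolding sq by (simp add: mult_ac)
  then have ynorm: "sqrt (sqnorm m y) \<le> c' * sqrt (sqnorm n x)"
  proof (cases "sqnorm m y = 0")
    case False
    then have "0 < sqrt (sqnorm m y)" using sqnorm_nonneg[of m y] by simp
    with * show ?thesis by (rule mult_left_le_imp_le)
  qed (use \<open>0 \<le> c'\<close> sqnorm_nonneg[of n x] in simp)
  have "\<bar>singular_value A 2\<bar> * sqrt (sqnorm n x) \<le> sqrt (sqnorm m y)"
    using real_sqrt_le_mono[OF le] by (simp add: y_def real_sqrt_mult)
  also note ynorm
  finally have "singular_value A 2 \<le> c'" using x(1) by simp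
  also have "c' = 4 * \<beta> * (sqrt (harmonic m) * sqrt (harmonic n))" by (simp add: c'_def)
  also have "\<dots> \<le> 4 * \<beta> * (sqrt (3 * ln m) * sqrt (3 * ln n))"
    using \<open>0 \<le> \<beta>\<close> mn
    by (intro mult_left_mono mult_mono real_sqrt_le_mono harmonic_le_3_ln) (auto simp: harmonic_nonneg)
  also have "\<dots> = 12 * \<beta> * sqrt (ln m * ln n)"
    by (simp add: real_sqrt_mult)
  finally show ?thesis unfolding \<beta>_def B_def m_def n_def .
qed

section \<open>Two opposite diagonal blocks\<close>

definition front_block :: "(nat \<Rightarrow> real) \<Rightarrow> nat \<Rightarrow> nat \<Rightarrow> real" where
  "front_block w k i = (if i < k then w i else 0)"

definition back_block :: "(nat \<Rightarrow> real) \<Rightarrow> nat \<Rightarrow> nat \<Rightarrow> real" where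
  "back_block w k i = (if k \<le> i \<and> i < 2 * k then w (i - k) else 0)"

text \<open>The matrix \<open>w z\<^sup>T\<close> and its negative on the diagonal, padded with zeros. Writing it as a difference of
two products, without a case distinction on blocks, makes every rectangle sum a difference of two products.\<close>
definition two_block_mat :: "nat \<Rightarrow> nat \<Rightarrow> (nat \<Rightarrow> real) \<Rightarrow> nat \<Rightarrow> (nat \<Rightarrow> real) \<Rightarrow> nat \<Rightarrow> complex mat" where
  "two_block_mat m n w k z l =
     mat m n (\<lambda>(i, j). of_real (front_block w k i * front_block z l j - back_block w k i * back_block z l j))"

lemma sum_front_subset:
  assumes "finite X"
  shows "sum (front_block w k) X = sum w (X \<inter> {..<k})"
  unfolding front_block_def using assms by (simp add: sum.inter_restrict)

lemma sum_back_subset: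
  assumes "finite X"
  shows "sum (back_block w k) X = sum w ((\<lambda>i. i - k) ` (X \<inter> {k..<2 * k}))"
proof -
  have "inj_on (\<lambda>i. i - k) (X \<inter> {k..<2 * k})" by (auto simp: inj_on_def)
  then have "sum w ((\<lambda>i. i - k) ` (X \<inter> {k..<2 * k})) = (\<Sum>i\<in>X \<inter> {k..<2 * k}. w (i - k))"
    by (simp add: sum.reindex)
  then show ?thesis
    unfolding back_block_def using assms by (simp add: sum.inter_restrict)
qed

lemma sum_front_back:
  assumes "2 * k \<le> m"
  shows "sum (front_block w k) {..<m} = sum w {..<k}" "sum (back_block w k) {..<m} = sum w {..<k}"
proof -
  have "{..<m} \<inter> {..<k} = {..<k}" using assms by auto
  then show "sum (front_block w k) {..<m} = sum w {..<k}" by (simp add: sum_front_subset)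
  have "(\<lambda>i. i - k) ` ({..<m} \<inter> {k..<2 * k}) = {..<k}"
  proof (intro equalityI subsetI)
    fix j assume "j \<in> {..<k}"
    then show "j \<in> (\<lambda>i. i - k) ` ({..<m} \<inter> {k..<2 * k})"
      using assms by (intro image_eqI[where x = "j + k"]) auto
  qed auto
  then show "sum (back_block w k) {..<m} = sum w {..<k}" by (simp add: sum_back_subset)
qed

lemma front_back_power2:
  "(front_block w k i)\<^sup>2 = front_block (\<lambda>i. (w i)\<^sup>2) k i" "(back_block w k i)\<^sup>2 = back_block (\<lambda>i. (w i)\<^sup>2) k i"
  by (simp_all add: front_block_def back_block_def)

lemma front_mult_back: "front_block w k i * back_block w k i = 0"
  by (simp add: front_block_def back_block_def)

context
  fixes m n k l :: nat and w z :: "nat \<Rightarrow> real" and A :: "complex mat"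
  assumes kl: "2 * k \<le> m" "2 * l \<le> n"
  defines "A \<equiv> two_block_mat m n w k z l"
begin

lemma two_block_dim: "dim_row A = m" "dim_col A = n"
  by (simp_all add: A_def two_block_mat_def)

lemma two_block_index:
  "i < m \<Longrightarrow> j < n \<Longrightarrow>
    A $$ (i, j) = of_real (front_block w k i * front_block z l j - back_block w k i * back_block z l j)"
  by (simp add: A_def two_block_mat_def)

lemma rect_sum_two_block:
  assumes "X \<subseteq> {..<m}" "Y \<subseteq> {..<n}"
  shows "rect_sum A X Y = of_real (sum (front_block w k) X * sum (front_block z l) Y - sum (back_block w k) X * sum (back_block z l) Y)"
proof -
  have "rect_sum A X Y = (\<Sum>i\<in>X. \<Sum>j\<in>Y. of_real (front_block w k i * front_block z l j - back_block w k i * back_block z l j))"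
    unfolding rect_sum_def using assms two_block_index by (intro sum.cong refl) blast
  also have "\<dots> = of_real (\<Sum>i\<in>X. \<Sum>j\<in>Y. front_block w k i * front_block z l j - back_block w k i * back_block z l j)"
    by simp
  also have "(\<Sum>i\<in>X. \<Sum>j\<in>Y. front_block w k i * front_block z l j - back_block w k i * back_block z l j) =
      sum (front_block w k) X * sum (front_block z l) Y - sum (back_block w k) X * sum (back_block z l) Y"
    unfolding sum_product by (simp only: sum_subtractf)
  finally show ?thesis .
qed

lemma density_two_block: "density A = 0"
proof -
  have "entry_sum A = rect_sum A {..<m} {..<n}"
    by (simp add: entry_sum_def rect_sum_def two_block_dim)
  also have "\<dots> = 0"
    using rect_sum_two_block[of "{..<m}" "{..<n}"] kl by (simp add: sum_front_back)
  finally show ?thesis by (simp add: density_def)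
qed

lemma two_block_centred: "density A \<cdot>\<^sub>m ones_mat m n = 0\<^sub>m m n" "A - density A \<cdot>\<^sub>m ones_mat m n = A"
  using two_block_dim by (auto simp: density_two_block ones_mat_def intro!: eq_matI)

text \<open>With \<open>u, u'\<close> and \<open>v, v'\<close> for the two copies of \<open>w\<close> and of \<open>z\<close>, the Gram matrix is
\<open>\<parallel>w\<parallel>\<^sup>2 (v v\<^sup>T + v' v'\<^sup>T)\<close>. Since \<open>v\<close> and \<open>v'\<close> are orthogonal of norm \<open>\<parallel>z\<parallel>\<close>, this is \<open>\<parallel>w\<parallel>\<^sup>2 \<parallel>z\<parallel>\<^sup>2\<close> times a
projection of rank two.\<close>
lemma singular_value_2_two_block:
  assumes mn: "2 \<le> m" "2 \<le> n" and pos: "0 < (\<Sum>i<k. (w i)\<^sup>2)" "0 < (\<Sum>j<l. (z j)\<^sup>2)"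
  shows "singular_value A 2 = sqrt (\<Sum>i<k. (w i)\<^sup>2) * sqrt (\<Sum>j<l. (z j)\<^sup>2)"
proof -
  define a b where "a = (\<Sum>i<k. (w i)\<^sup>2)" and "b = (\<Sum>j<l. (z j)\<^sup>2)"
  define u u' where "u i = complex_of_real (front_block w k i)" and "u' i = complex_of_real (back_block w k i)" for i
  define v v' where "v j = complex_of_real (front_block z l j)" and "v' j = complex_of_real (back_block z l j)" for j
  have [simp]: "cnj (u i) = u i" "cnj (u' i) = u' i" "cnj (v i) = v i" "cnj (v' i) = v' i" for i
    by (simp_all add: u_def u'_def v_def v'_def)
  have A: "A $$ (i, j) = u i * v j - u' i * v' j" if "i < m" "j < n" for i j
    using that by (simp add: two_block_index u_def u'_def v_def v'_def)
  have norms: "(\<Sum>i<m. front_block w k i * front_block w k i) = a"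
    "(\<Sum>i<m. back_block w k i * back_block w k i) = a"
    "(\<Sum>j<n. front_block z l j * front_block z l j) = b"
    "(\<Sum>j<n. back_block z l j * back_block z l j) = b"
    unfolding a_def b_def power2_eq_square[symmetric] front_back_power2
    by (rule sum_front_back[OF kl(1)] sum_front_back[OF kl(2)])+
  have uu: "(\<Sum>i<m. u i * u i) = of_real a" "(\<Sum>i<m. u' i * u' i) = of_real a"
    and vv: "(\<Sum>j<n. v j * v j) = of_real b" "(\<Sum>j<n. v' j * v' j) = of_real b"
    unfolding u_def u'_def v_def v'_def of_real_mult[symmetric] of_real_sum[symmetric] norms by (rule refl)+
  have cross: "u i * u' i = 0" "u' i * u i = 0" "v i * v' i = 0" "v' i * v i = 0" for i
    unfolding u_def u'_def v_def v'_def of_real_mult[symmetric] using front_mult_back by (simp_all add: mult.commute)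
  define V V' where "V x = (\<Sum>j<n. v j * x j)" and "V' x = (\<Sum>j<n. v' j * x j)" for x
  have app: "mat_app A x i = u i * V x - u' i * V' x" if "i < m" for x i
    unfolding mat_app_def two_block_dim V_def V'_def sum_distrib_left sum_subtractf[symmetric]
    using that by (intro sum.cong refl) (simp add: A algebra_simps)
  have gram: "gram_app A x j = of_real a * (V x * v j + V' x * v' j)" if "j < n" for x j
  proof -
    have "gram_app A x j = (\<Sum>i<m. (u i * u i) * (V x * v j) + (u' i * u' i) * (V' x * v' j))"
      unfolding gram_app_def two_block_dim
    proof (intro sum.cong refl)
      fix i assume "i \<in> {..<m}"
      then have "cnj (A $$ (i, j)) * mat_app A x i =
          (u i * u i) * (V x * v j) + (u' i * u' i) * (V' x * v' j)
          - (u i * u' i) * (v j * V' x) - (u' i * u i) * (v' j * V x)"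
        using that by (simp add: A app algebra_simps)
      then show "cnj (A $$ (i, j)) * mat_app A x i =
          (u i * u i) * (V x * v j) + (u' i * u' i) * (V' x * v' j)" by (simp add: cross)
    qed
    also have "\<dots> = of_real a * (V x * v j) + of_real a * (V' x * v' j)"
      unfolding sum.distrib sum_distrib_right[symmetric] uu ..
    finally show ?thesis by (simp add: algebra_simps)
  qed
  have V: "V (gram_app A x) = of_real (a * b) * V x" for x
  proof -
    have "V (gram_app A x) = (\<Sum>j<n. (v j * v j) * (of_real a * V x) + (v j * v' j) * (of_real a * V' x))"
      unfolding V_def[of "gram_app A x"] by (intro sum.cong refl) (simp add: gram algebra_simps)
    also have "\<dots> = of_real b * (of_real a * V x)"
      unfolding cross by (simp add: sum_distrib_right[symmetric] vv)
    finally show ?thesis by simp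
  qed
  have V': "V' (gram_app A x) = of_real (a * b) * V' x" for x
  proof -
    have "V' (gram_app A x) = (\<Sum>j<n. (v' j * v' j) * (of_real a * V' x) + (v' j * v j) * (of_real a * V x))"
      unfolding V'_def[of "gram_app A x"] by (intro sum.cong refl) (simp add: gram algebra_simps)
    also have "\<dots> = of_real b * (of_real a * V' x)"
      unfolding cross by (simp add: sum_distrib_right[symmetric] vv)
    finally show ?thesis by simp
  qed
  have "gram_eigenvalues A ! 1 = a * b"
  proof (rule gram_eigenvalue_1_of_projection)
    show "2 \<le> dim_col A" using mn two_block_dim by simp
    show "0 < a * b" using pos by (simp add: a_def b_def)
    show "gram_app A (gram_app A x) j = of_real (a * b) * gram_app A x j" if "j < dim_col A" for x j
      using that by (simp add: gram two_block_dim V V' algebra_simps)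
    have "complex_of_real (\<Sum>j<n. \<Sum>i<m. (cmod (A $$ (i, j)))\<^sup>2) =
        (\<Sum>j<n. \<Sum>i<m. (u i * u i) * (v j * v j) + (u' i * u' i) * (v' j * v' j))"
      unfolding of_real_sum
    proof (intro sum.cong refl)
      fix i j assume "j \<in> {..<n}" "i \<in> {..<m}"
      then have "complex_of_real ((cmod (A $$ (i, j)))\<^sup>2) =
          (u i * u i) * (v j * v j) + (u' i * u' i) * (v' j * v' j)
          - (u i * u' i) * (v j * v' j) - (u' i * u i) * (v' j * v j)"
        unfolding complex_norm_square by (simp only: lessThan_iff A) (simp add: algebra_simps)
      then show "complex_of_real ((cmod (A $$ (i, j)))\<^sup>2) =
          (u i * u i) * (v j * v j) + (u' i * u' i) * (v' j * v' j)" by (simp add: cross)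
    qed
    also have "\<dots> = of_real (2 * (a * b))"
      unfolding sum.distrib sum_distrib_right[symmetric] uu sum_distrib_left[symmetric] vv by simp
    finally show "(\<Sum>j<dim_col A. \<Sum>i<dim_row A. (cmod (A $$ (i, j)))\<^sup>2) = 2 * (a * b)"
      unfolding of_real_eq_iff two_block_dim .
  qed
  then show ?thesis
    using singular_value_2(1)[of A] mn by (simp add: two_block_dim real_sqrt_mult a_def b_def)
qed

text \<open>A rectangle \<open>X \<times> Y\<close> meets each of the two blocks in a rectangle with at most as many rows and columns.\<close>
lemma rect_sum_two_block_le:
  assumes "X \<subseteq> {..<m}" "Y \<subseteq> {..<n}"
    and w: "\<And>X'. finite X' \<Longrightarrow> X' \<subseteq> {..<k} \<Longrightarrow> card X' \<le> card X \<Longrightarrow> \<bar>sum w X'\<bar> \<le> p"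
    and z: "\<And>Y'. finite Y' \<Longrightarrow> Y' \<subseteq> {..<l} \<Longrightarrow> card Y' \<le> card Y \<Longrightarrow> \<bar>sum z Y'\<bar> \<le> q"
  shows "cmod (rect_sum A X Y) \<le> 2 * (p * q)"
proof -
  have fin: "finite X" "finite Y" using assms finite_subset by blast+
  have "\<bar>sum (front_block w k) X\<bar> \<le> p" "\<bar>sum (front_block z l) Y\<bar> \<le> q"
    unfolding sum_front_subset[OF fin(1)] sum_front_subset[OF fin(2)]
    using fin by (auto intro!: w z card_mono)
  moreover have "\<bar>sum (back_block w k) X\<bar> \<le> p" "\<bar>sum (back_block z l) Y\<bar> \<le> q"
    unfolding sum_back_subset[OF fin(1)] sum_back_subset[OF fin(2)]
    using fin by (auto intro!: w z order_trans[OF card_image_le card_mono])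
  ultimately have "\<bar>sum (front_block w k) X\<bar> * \<bar>sum (front_block z l) Y\<bar> + \<bar>sum (back_block w k) X\<bar> * \<bar>sum (back_block z l) Y\<bar> \<le> p * q + p * q"
    by (intro add_mono mult_mono) auto
  then show ?thesis
    unfolding rect_sum_two_block[OF assms(1,2)] norm_of_real
    using abs_triangle_ineq4[of "sum (front_block w k) X * sum (front_block z l) Y" "sum (back_block w k) X * sum (back_block z l) Y"]
    by (simp add: abs_mult)
qed

end

section \<open>Tightness\<close>

text \<open>The largest index is at least the number of the other indices, so its term is at
most the increment of \<open>2 \<surd>k\<close> from the cardinality without it to the cardinality with it.\<close>
lemma sum_inverse_sqrt_le: "finite X \<Longrightarrow> (\<Sum>i\<in>X. 1 / sqrt (real (Suc i))) \<le> 2 * sqrt (card X)"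
proof (induction "card X" arbitrary: X)
  case (Suc k)
  define a where "a = Max X"
  have a: "a \<in> X" using Suc unfolding a_def by (intro Max_in) auto
  have "X \<subseteq> {..a}" using Suc by (auto simp: a_def)
  then have "card X \<le> Suc a" using card_mono[of "{..a}" X] by simp
  then have "1 / sqrt (real (Suc a)) \<le> 1 / sqrt (real (Suc k))"
    using Suc(2) by (intro divide_left_mono) auto
  also have "\<dots> \<le> 2 * sqrt (real (Suc k)) - 2 * sqrt (real k)"
  proof -
    have "1 = (sqrt (real (Suc k)) - sqrt (real k)) * (sqrt (real (Suc k)) + sqrt (real k))"
      by (simp add: algebra_simps)
    also have "\<dots> \<le> (sqrt (real (Suc k)) - sqrt (real k)) * (2 * sqrt (real (Suc k)))"
      by (intro mult_left_mono) auto
    finally show ?thesis by (simp add: field_simps)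
  qed
  finally have "1 / sqrt (real (Suc a)) \<le> 2 * sqrt (real (Suc k)) - 2 * sqrt (real k)" .
  moreover have "card (X - {a}) = k" using Suc(2,3) a by simp
  then have "(\<Sum>i\<in>X - {a}. 1 / sqrt (real (Suc i))) \<le> 2 * sqrt (real k)"
    using Suc(1)[of "X - {a}"] Suc(3) by (metis finite_Diff)
  ultimately show ?case
    using Suc(2,3) a by (simp add: sum.remove[of X a])
qed simp

text \<open>Blocks with a single row serve while \<open>t \<le> n div 2\<close>; beyond that the blocks get \<open>n div 2\<close> columns, and
the number of their rows is adjusted to \<open>t\<close>. The factor \<open>9\<close> comes from \<open>m \<le> 3 (m div 2)\<close> and the same for \<open>n\<close>.\<close>
lemma exists_block_size:
  assumes "2 \<le> m" "2 \<le> n" "1 \<le> t" "t \<le> real m * real n"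
  obtains k l :: nat where "0 < k" "0 < l" "2 * k \<le> m" "2 * l \<le> n"
    "t / 9 \<le> real k * real l" "real k * real l \<le> t"
proof -
  define M N where "M = m div 2" and "N = n div 2"
  have M: "0 < M" "2 * M \<le> m" "m \<le> 3 * M" and N: "0 < N" "2 * N \<le> n" "n \<le> 3 * N"
    using assms by (auto simp: M_def N_def)
  have half: "s / 2 \<le> real (nat \<lfloor>s\<rfloor>) \<and> real (nat \<lfloor>s\<rfloor>) \<le> s \<and> 0 < nat \<lfloor>s\<rfloor>" if "1 \<le> s" for s :: real
  proof -
    have "1 \<le> \<lfloor>s\<rfloor>" using that by simp
    moreover from this have "real (nat \<lfloor>s\<rfloor>) = of_int \<lfloor>s\<rfloor>" by simp
    ultimately show ?thesis using floor_correct[of s] by linarith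
  qed
  show thesis
  proof (cases "t \<le> real N")
    case True
    have "nat \<lfloor>t\<rfloor> \<le> N" using True by linarith
    then show thesis
      using that[of 1 "nat \<lfloor>t\<rfloor>"] half[OF assms(3)] M N assms by simp
  next
    case False
    define k where "k = nat \<lfloor>t / real N\<rfloor>"
    have k: "t / real N / 2 \<le> real k" "real k \<le> t / real N" "0 < k"
      using half[of "t / real N"] False N by (auto simp: k_def field_simps)
    then have k': "t / 2 \<le> real k * real N" "real k * real N \<le> t"
      using N by (auto simp: field_simps)
    show thesis
    proof (cases "k \<le> M")
      case True
      then show thesis using that[of k N] k k' M N assms by simp
    next
      case False
      have "t \<le> real (3 * M) * real (3 * N)"
        using assms(4) M N by (meson mult_mono of_nat_0_le_iff of_nat_mono order_trans)
      moreover have "real M * real N \<le> real k * real N" using False by (intro mult_right_mono) auto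
      then have "real M * real N \<le> t" using k'(2) by linarith
      ultimately show thesis using that[of M N] M N by simp
    qed
  qed
qed

text \<open>The rectangle of the first block and the bound for each block give
\<open>k l \<le> m n \<parallel>A\<parallel> \<le> 2 k l\<close> for the cut-norm, and the second singular value is \<open>\<surd>(k l)\<close>.\<close>
lemma cut_norm_tight:
  assumes mn: "2 \<le> m" "2 \<le> n" and \<epsilon>: "1 / (real m * real n) \<le> \<epsilon>" "\<epsilon> \<le> 1"
  shows "\<exists>A \<in> carrier_mat m n. (\<forall>i<m. \<forall>j<n. cmod (A $$ (i, j)) \<le> 1) \<and>
     1 / 9 * \<epsilon> \<le> cut_norm (A - density A \<cdot>\<^sub>m ones_mat m n) \<and>
     1 / 9 * cut_norm (A - density A \<cdot>\<^sub>m ones_mat m n) \<le> \<epsilon> \<and>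
     1 / 9 * sqrt (cut_norm (A - density A \<cdot>\<^sub>m ones_mat m n) * (real m * real n)) \<le> singular_value A 2"
proof -
  have pos: "0 < real m * real n" using mn by simp
  have t: "1 \<le> \<epsilon> * (real m * real n)" "\<epsilon> * (real m * real n) \<le> real m * real n"
    using \<epsilon> pos mult_right_mono[of \<epsilon> 1 "real m * real n"] by (simp_all add: divide_le_eq)
  obtain k l where kl: "0 < k" "0 < l" "2 * k \<le> m" "2 * l \<le> n"
    and lo: "\<epsilon> * (real m * real n) / 9 \<le> real k * real l" and hi: "real k * real l \<le> \<epsilon> * (real m * real n)"
    using exists_block_size[OF mn t] by blast
  define A where "A = two_block_mat m n (\<lambda>_. 1) k (\<lambda>_. 1) l"
  note dim = two_block_dim[OF kl(3,4), of "\<lambda>_. 1" "\<lambda>_. 1", folded A_def]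
  note idx = two_block_index[OF kl(3,4), of _ _ "\<lambda>_. 1" "\<lambda>_. 1", folded A_def]
  note centred = two_block_centred(2)[OF kl(3,4), of "\<lambda>_. 1" "\<lambda>_. 1", folded A_def]
  have sv: "singular_value A 2 = sqrt (real k * real l)"
    using singular_value_2_two_block[OF kl(3,4) mn, of "\<lambda>_. 1" "\<lambda>_. 1", folded A_def] kl
    by (simp add: real_sqrt_mult)
  have entries: "cmod (A $$ (i, j)) \<le> 1" if "i < m" "j < n" for i j
    using that by (simp only: idx norm_of_real) (simp add: front_block_def back_block_def)
  have up: "cut_norm A \<le> 2 * (real k * real l) / (real m * real n)"
  proof (rule cut_norm_le, unfold dim)
    fix X Y assume XY: "X \<subseteq> {..<m}" "Y \<subseteq> {..<n}"
    have "\<bar>\<Sum>i\<in>X'. 1 :: real\<bar> \<le> real c" if "X' \<subseteq> {..<c}" for X' c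
      using card_mono[OF _ that] by simp
    then have "cmod (rect_sum A X Y) \<le> 2 * (real k * real l)"
      unfolding A_def by (intro rect_sum_two_block_le[OF kl(3,4) XY]) auto
    then show "cmod (rect_sum A X Y) / (real m * real n) \<le> 2 * (real k * real l) / (real m * real n)"
      using pos by (intro divide_right_mono) auto
  qed
  have low: "real k * real l / (real m * real n) \<le> cut_norm A"
  proof -
    have "rect_sum A {..<k} {..<l} = of_real (real k * real l)"
    proof -
      have "sum (front_block (\<lambda>_. 1) k) {..<k} = real k" "sum (front_block (\<lambda>_. 1) l) {..<l} = real l"
        "sum (back_block (\<lambda>_. 1) k) {..<k} = 0"
        by (auto simp: front_block_def back_block_def)
      then show ?thesis
        using rect_sum_two_block[OF kl(3,4), of "{..<k}" "{..<l}" "\<lambda>_. 1" "\<lambda>_. 1", folded A_def] kl by simp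
    qed
    then show ?thesis
      using rect_sum_le_cut_norm[of "{..<k}" A "{..<l}"] kl dim by (simp add: norm_mult)
  qed
  have "1 / 9 * \<epsilon> \<le> real k * real l / (real m * real n)" using lo pos by (simp add: field_simps)
  then have 1: "1 / 9 * \<epsilon> \<le> cut_norm A" using low by linarith
  have "2 * (real k * real l) / (real m * real n) \<le> 2 * \<epsilon>" using hi pos by (simp add: field_simps)
  then have "cut_norm A \<le> 2 * \<epsilon>" using up by linarith
  moreover have "0 \<le> \<epsilon>" using \<epsilon>(1) pos by (meson divide_nonneg_nonneg order_trans less_imp_le zero_le_one)
  ultimately have 2: "1 / 9 * cut_norm A \<le> \<epsilon>" by linarith
  have "cut_norm A * (real m * real n) \<le> 2 * (real k * real l)"
    using up pos by (simp add: field_simps)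
  also have "\<dots> \<le> 9\<^sup>2 * (real k * real l)" by simp
  finally have "sqrt (cut_norm A * (real m * real n)) \<le> sqrt (9\<^sup>2 * (real k * real l))"
    by (rule real_sqrt_le_mono)
  also have "\<dots> = 9 * sqrt (real k * real l)" unfolding real_sqrt_mult by simp
  finally have 3: "1 / 9 * sqrt (cut_norm A * (real m * real n)) \<le> singular_value A 2"
    unfolding sv by simp
  show ?thesis
  proof (rule bexI)
    show "A \<in> carrier_mat m n" using dim by (rule carrier_matI)
    show "(\<forall>i<m. \<forall>j<n. cmod (A $$ (i, j)) \<le> 1) \<and>
       1 / 9 * \<epsilon> \<le> cut_norm (A - density A \<cdot>\<^sub>m ones_mat m n) \<and>
       1 / 9 * cut_norm (A - density A \<cdot>\<^sub>m ones_mat m n) \<le> \<epsilon> \<and>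
       1 / 9 * sqrt (cut_norm (A - density A \<cdot>\<^sub>m ones_mat m n) * (real m * real n)) \<le> singular_value A 2"
      unfolding centred using 1 2 3 entries by blast
  qed
qed

text \<open>Each block contributes at most \<open>2 \<surd>\<bar>X\<bar> \<cdot> 2 \<surd>\<bar>Y\<bar>\<close> to a rectangle sum, so the boxdot norm is at most
\<open>8\<close>. Half-length vectors lose only a factor in the logarithm, as \<open>(m div 2 + 1)\<^sup>2 \<ge> m\<close>.\<close>
lemma boxdot_norm_tight:
  assumes mn: "2 \<le> m" "2 \<le> n"
  shows "\<exists>A \<in> carrier_mat m n. A \<noteq> density A \<cdot>\<^sub>m ones_mat m n \<and>
     1 / 16 * boxdot_norm (A - density A \<cdot>\<^sub>m ones_mat m n) * sqrt (ln (real m) * ln (real n))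
       \<le> singular_value A 2"
proof -
  define w where "w i = 1 / sqrt (real (Suc i))" for i
  define k l where "k = m div 2" and "l = n div 2"
  have kl: "2 * k \<le> m" "2 * l \<le> n" "0 < k" "0 < l" using mn by (auto simp: k_def l_def)
  define A where "A = two_block_mat m n w k w l"
  note dim = two_block_dim[OF kl(1,2), of w w, folded A_def]
  note idx = two_block_index[OF kl(1,2), of _ _ w w, folded A_def]
  note centred = two_block_centred[OF kl(1,2), of w w, folded A_def]
  have norm_w: "(\<Sum>i<c. (w i)\<^sup>2) = harmonic c" for c
    by (simp add: w_def harmonic_def power_divide)
  have harm: "ln (real c) / 2 \<le> harmonic (c div 2)" if "2 \<le> c" for c
  proof -
    have "real c \<le> real ((Suc (c div 2))\<^sup>2)"
    proof -
      have "c \<le> 2 * (c div 2) + 1" by simp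
      also have "\<dots> \<le> (Suc (c div 2))\<^sup>2" by (simp add: power2_eq_square)
      finally show ?thesis by (rule of_nat_mono)
    qed
    then have "ln (real c) \<le> ln (real ((Suc (c div 2))\<^sup>2))" using that by simp
    also have "\<dots> = 2 * ln (real (Suc (c div 2)))" by (simp add: ln_realpow)
    finally show ?thesis using ln_le_harmonic[of "c div 2"] by linarith
  qed
  have ln_pos: "0 < ln (real m)" "0 < ln (real n)" using mn by auto
  then have hpos: "0 < harmonic k" "0 < harmonic l"
    using harm mn unfolding k_def l_def by (meson half_gt_zero less_le_trans)+
  have sv: "singular_value A 2 = sqrt (harmonic k) * sqrt (harmonic l)"
    using singular_value_2_two_block[OF kl(1,2) mn, of w w, folded A_def] hpos unfolding norm_w by simp
  have "boxdot_norm A \<le> 8"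
  proof (rule boxdot_norm_le, unfold dim)
    fix X Y assume XY: "X \<subseteq> {..<m}" "Y \<subseteq> {..<n}"
    have "\<bar>sum w X'\<bar> \<le> 2 * sqrt (card Z)" if "finite X'" "card X' \<le> card Z" for X' Z :: "nat set"
    proof -
      have "\<bar>sum w X'\<bar> = sum w X'" by (intro abs_of_nonneg sum_nonneg) (simp add: w_def)
      also have "\<dots> \<le> 2 * sqrt (card X')" unfolding w_def by (rule sum_inverse_sqrt_le[OF that(1)])
      finally show ?thesis using that(2) real_sqrt_le_mono[of "card X'" "card Z"] by linarith
    qed
    then have "cmod (rect_sum A X Y) \<le> 2 * ((2 * sqrt (card X)) * (2 * sqrt (card Y)))"
      unfolding A_def by (intro rect_sum_two_block_le[OF kl(1,2) XY]) auto
    then show "cmod (rect_sum A X Y) \<le> 8 * sqrt (card X) * sqrt (card Y)" by simp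
  qed (use mn in auto)
  then have "1 / 16 * boxdot_norm A * sqrt (ln m * ln n) \<le> 1 / 16 * 8 * sqrt (ln m * ln n)"
    using ln_pos by (intro mult_right_mono) auto
  also have "\<dots> = sqrt (ln m / 2) * sqrt (ln n / 2)"
    by (simp add: real_sqrt_mult real_sqrt_divide)
  also have "\<dots> \<le> sqrt (harmonic k) * sqrt (harmonic l)"
    using harm mn ln_pos unfolding k_def l_def by (intro mult_mono real_sqrt_le_mono) (auto simp: harmonic_nonneg)
  finally have 1: "1 / 16 * boxdot_norm A * sqrt (ln m * ln n) \<le> singular_value A 2"
    unfolding sv .
  have "A $$ (0, 0) = 1" using idx[of 0 0] mn kl by (simp add: front_block_def back_block_def w_def)
  then have "A \<noteq> 0\<^sub>m m n" using mn by auto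
  then have "A \<noteq> density A \<cdot>\<^sub>m ones_mat m n \<and>
      1 / 16 * boxdot_norm (A - density A \<cdot>\<^sub>m ones_mat m n) * sqrt (ln (real m) * ln (real n))
        \<le> singular_value A 2"
    unfolding centred(2) unfolding centred(1) using 1 by blast
  then show ?thesis using carrier_matI[OF dim] by blast
qed

section \<open>The two inequalities and their tightness\<close>

theorem theorem5:
  shows
   "(\<forall>m n. \<forall>A \<in> carrier_mat m n. 0 < m \<longrightarrow> 0 < n \<longrightarrow>
       (\<forall>i<m. \<forall>j<n. cmod (A $$ (i, j)) \<le> 1) \<longrightarrow>
       singular_value A 2
         \<le> 4 * sqrt (cut_norm (A - density A \<cdot>\<^sub>m ones_mat m n) * (real m * real n)))
  \<and> (\<exists>C::real. 0 < C \<and> C < 10 ^ 5 \<and>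
       (\<forall>m n. \<forall>A \<in> carrier_mat m n. 0 < m \<longrightarrow> 0 < n \<longrightarrow>
          singular_value A 2
            \<le> C * boxdot_norm (A - density A \<cdot>\<^sub>m ones_mat m n)
                * sqrt (ln (real m) * ln (real n))
          \<and> (2 \<le> m \<longrightarrow> 2 \<le> n \<longrightarrow> A \<noteq> density A \<cdot>\<^sub>m ones_mat m n \<longrightarrow>
               singular_value A 2
                 < C * boxdot_norm (A - density A \<cdot>\<^sub>m ones_mat m n)
                     * sqrt (ln (real m) * ln (real n)))))
  \<and> (\<exists>c::real. 0 < c \<and>
       (\<forall>m n. \<forall>\<epsilon>::real. 2 \<le> m \<longrightarrow> 2 \<le> n \<longrightarrow> 1 / (real m * real n) \<le> \<epsilon> \<longrightarrow> \<epsilon> \<le> 1 \<longrightarrow>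
          (\<exists>A \<in> carrier_mat m n.
             (\<forall>i<m. \<forall>j<n. cmod (A $$ (i, j)) \<le> 1) \<and>
             c * \<epsilon> \<le> cut_norm (A - density A \<cdot>\<^sub>m ones_mat m n) \<and>
             c * cut_norm (A - density A \<cdot>\<^sub>m ones_mat m n) \<le> \<epsilon> \<and>
             c * sqrt (cut_norm (A - density A \<cdot>\<^sub>m ones_mat m n) * (real m * real n))
               \<le> singular_value A 2)))
  \<and> (\<exists>c::real. 0 < c \<and>
       (\<forall>m n. 2 \<le> m \<longrightarrow> 2 \<le> n \<longrightarrow>
          (\<exists>A \<in> carrier_mat m n.
             A \<noteq> density A \<cdot>\<^sub>m ones_mat m n \<and>
             c * boxdot_norm (A - density A \<cdot>\<^sub>m ones_mat m n) * sqrt (ln (real m) * ln (real n))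
               \<le> singular_value A 2)))"
proof (intro conjI)
  show "\<forall>m n. \<forall>A \<in> carrier_mat m n. 0 < m \<longrightarrow> 0 < n \<longrightarrow>
       (\<forall>i<m. \<forall>j<n. cmod (A $$ (i, j)) \<le> 1) \<longrightarrow>
       singular_value A 2
         \<le> 4 * sqrt (cut_norm (A - density A \<cdot>\<^sub>m ones_mat m n) * (real m * real n))"
  proof (intro allI ballI impI)
    fix m n and A :: "complex mat"
    assume A: "A \<in> carrier_mat m n" and "\<forall>i<m. \<forall>j<n. cmod (A $$ (i, j)) \<le> 1"
    then have "\<And>i j. i < dim_row A \<Longrightarrow> j < dim_col A \<Longrightarrow> cmod (A $$ (i, j)) \<le> 1" by simp
    from singular_value_2_le_cut_norm[OF this, of "density A"]
    show "singular_value A 2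
         \<le> 4 * sqrt (cut_norm (A - density A \<cdot>\<^sub>m ones_mat m n) * (real m * real n))"
      unfolding carrier_matD[OF A] by blast
  qed
next
  show "\<exists>C::real. 0 < C \<and> C < 10 ^ 5 \<and>
       (\<forall>m n. \<forall>A \<in> carrier_mat m n. 0 < m \<longrightarrow> 0 < n \<longrightarrow>
          singular_value A 2
            \<le> C * boxdot_norm (A - density A \<cdot>\<^sub>m ones_mat m n)
                * sqrt (ln (real m) * ln (real n))
          \<and> (2 \<le> m \<longrightarrow> 2 \<le> n \<longrightarrow> A \<noteq> density A \<cdot>\<^sub>m ones_mat m n \<longrightarrow>
               singular_value A 2
                 < C * boxdot_norm (A - density A \<cdot>\<^sub>m ones_mat m n)
                     * sqrt (ln (real m) * ln (real n))))"
    \<comment> \<open>The inequality holds with constant \<open>12\<close>; the margin makes it strict when the right side is positive.\<close>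
  proof (intro exI[of _ "13 :: real"] conjI allI ballI impI)
    fix m n and A :: "complex mat"
    assume A: "A \<in> carrier_mat m n" and mn: "0 < m" "0 < n"
    define B L where "B = A - density A \<cdot>\<^sub>m ones_mat m n" and "L = sqrt (ln (real m) * ln (real n))"
    have dimB: "dim_row B = m" "dim_col B = n" by (simp_all add: B_def ones_mat_def)
    have "0 \<le> L" using mn by (simp add: L_def)
    have "0 \<le> boxdot_norm B" using boxdot_norm_nonneg[of B] dimB mn by simp
    have le: "singular_value A 2 \<le> 12 * boxdot_norm B * L" if "2 \<le> m" "2 \<le> n"
      using singular_value_2_le_boxdot_norm[of A "density A"] that
      unfolding carrier_matD[OF A] B_def L_def by blast
    show "singular_value A 2 \<le> 13 * boxdot_norm (A - density A \<cdot>\<^sub>m ones_mat m n)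
        * sqrt (ln (real m) * ln (real n))"
      unfolding B_def[symmetric] L_def[symmetric]
    proof (cases "2 \<le> m \<and> 2 \<le> n")
      case True
      have "12 * boxdot_norm B * L \<le> 13 * boxdot_norm B * L"
        using \<open>0 \<le> L\<close> \<open>0 \<le> boxdot_norm B\<close> by (intro mult_right_mono) auto
      then show "singular_value A 2 \<le> 13 * boxdot_norm B * L" using le True by linarith
    next
      case False
      then have "singular_value A 2 = 0"
        using A by (intro singular_value_2_trivial) auto
      then show "singular_value A 2 \<le> 13 * boxdot_norm B * L"
        using \<open>0 \<le> L\<close> \<open>0 \<le> boxdot_norm B\<close> by simp
    qed
    assume mn2: "2 \<le> m" "2 \<le> n" and ne: "A \<noteq> density A \<cdot>\<^sub>m ones_mat m n"
    obtain i j where ij: "i < m" "j < n" "A $$ (i, j) \<noteq> (density A \<cdot>\<^sub>m ones_mat m n) $$ (i, j)"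
      using ne A eq_matI[of "density A \<cdot>\<^sub>m ones_mat m n" A] by (auto simp: ones_mat_def)
    then have "B $$ (i, j) \<noteq> 0" using A by (simp add: B_def ones_mat_def)
    then have "0 < boxdot_norm B"
      using entry_le_boxdot_norm[of i B j] ij dimB by (metis norm_le_zero_iff not_le order_trans)
    moreover have "0 < L" using mn2 by (simp add: L_def)
    ultimately have "12 * boxdot_norm B * L < 13 * boxdot_norm B * L" by simp
    then show "singular_value A 2 < 13 * boxdot_norm (A - density A \<cdot>\<^sub>m ones_mat m n)
        * sqrt (ln (real m) * ln (real n))"
      unfolding B_def[symmetric] L_def[symmetric] using le mn2 by linarith
  qed simp_all
next
  show "\<exists>c::real. 0 < c \<and>
       (\<forall>m n. \<forall>\<epsilon>::real. 2 \<le> m \<longrightarrow> 2 \<le> n \<longrightarrow> 1 / (real m * real n) \<le> \<epsilon> \<longrightarrow> \<epsilon> \<le> 1 \<longrightarrow>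
          (\<exists>A \<in> carrier_mat m n.
             (\<forall>i<m. \<forall>j<n. cmod (A $$ (i, j)) \<le> 1) \<and>
             c * \<epsilon> \<le> cut_norm (A - density A \<cdot>\<^sub>m ones_mat m n) \<and>
             c * cut_norm (A - density A \<cdot>\<^sub>m ones_mat m n) \<le> \<epsilon> \<and>
             c * sqrt (cut_norm (A - density A \<cdot>\<^sub>m ones_mat m n) * (real m * real n))
               \<le> singular_value A 2))"
    by (rule exI[of _ "1 / 9"], intro conjI allI impI cut_norm_tight) simp
next
  show "\<exists>c::real. 0 < c \<and>
       (\<forall>m n. 2 \<le> m \<longrightarrow> 2 \<le> n \<longrightarrow>
          (\<exists>A \<in> carrier_mat m n.
             A \<noteq> density A \<cdot>\<^sub>m ones_mat m n \<and>
             c * boxdot_norm (A - density A \<cdot>\<^sub>m ones_mat m n) * sqrt (ln (real m) * ln (real n))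
               \<le> singular_value A 2))"
    by (rule exI[of _ "1 / 16"], intro conjI allI impI boxdot_norm_tight) simp
qed

end
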